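(* Let $\Gamma$ be the infinite dihedral group, with generators $S,e$ satisfying $e^2=1$, $eSe=S^{-1}$. Let $\psi_0,\psi_1,\psi_2$ be the linear functionals on $\mathbf{C}\Gamma$ defined by $$\psi_0(S^m)=\delta_{m,0},\quad \psi_0(S^me)=0;$$ $$\psi_1(S^m)=0,\quad \psi_1(S^{2m}e)=2,\quad \psi_1(S^{2m+1}e)=0;$$ $$\psi_2(S^m)=0,\quad \psi_2(S^{2m}e)=0,\quad \psi_2(S^{2m+1}e)=2$$ for all $m\in\mathbf{Z}$. Then the cyclic 0-cocycles $\psi_0,\psi_1,\psi_2$ generate the even periodic cyclic cohomology $HC^{even}(\mathbf{C}\Gamma)\cong\mathbf{C}^3$.
   Context: The infinite dihedral group is $\Gamma=\mathbf{Z}\times_\sigma\mathbf{Z}_2$ with $\mathbf{Z}_2$ acting on $\mathbf{Z}$ by inversion. A cyclic 0-cocycle on $\mathbf{C}\Gamma$ is a linear functional $\psi$ with $\psi(xy)=\psi(yx)$. Cyclic cohomology $HC^n$ is the cohomology of the complex of $(n+1)$-linear functionals $\varphi$ with $\varphi(a_1,\dots,a_n,a_0)=(-1)^n\varphi(a_0,\dots,a_n)$, with the Hochschild coboundary $b$. The even periodic cyclic cohomology $HC^{even}(\mathbf{C}\Gamma)$ is the direct limit of the groups $HC^{2n}(\mathbf{C}\Gamma)$ under Connes' periodicity operator $HC^{i}\to HC^{i+2}$; a 0-cocycle defines a class in it via $HC^0$. "Generate" means as a complex vector space. *)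

theory Defs
  imports
    "HOL-Analysis.Finite_Cartesian_Product"
    "HOL-Library.Poly_Mapping"
    "HOL-Algebra.Module"
    "HOL-Algebra.AbelCoset"
begin

section \<open>Linear algebra over the complex numbers\<close>

text \<open>
  Complex vector spaces with explicit carriers are rendered as records of type
  \<^typ>\<open>(complex, 'b) module\<close>; their multiplicative fields are not used.
\<close>

definition mk_space ::
  "'b set \<Rightarrow> 'b \<Rightarrow> ('b \<Rightarrow> 'b \<Rightarrow> 'b) \<Rightarrow> (complex \<Rightarrow> 'b \<Rightarrow> 'b) \<Rightarrow> (complex, 'b) module" where
  "mk_space V z p s =
     \<lparr>carrier = V, mult = undefined, one = undefined, zero = z, add = p, smult = s\<rparr>"

lemma mk_space_simps [simp]:
  "carrier (mk_space V z p s) = V"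
  "zero (mk_space V z p s) = z"
  "add (mk_space V z p s) = p"
  "smult (mk_space V z p s) = s"
  by (simp_all add: mk_space_def)

definition quot_space :: "(complex, 'b) module \<Rightarrow> 'b set \<Rightarrow> (complex, 'b set) module" where
  "quot_space M N =
     mk_space (a_rcosets\<^bsub>M\<^esub> N) N (set_add M)
       (\<lambda>c X. \<Union>x\<in>X. N +>\<^bsub>M\<^esub> (c \<odot>\<^bsub>M\<^esub> x))"

definition space_iso :: "(complex, 'b) module \<Rightarrow> (complex, 'c) module \<Rightarrow> ('b \<Rightarrow> 'c) set" where
  "space_iso M N =
     {h \<in> iso (add_monoid M) (add_monoid N).
        \<forall>c. \<forall>x\<in>carrier M. h (c \<odot>\<^bsub>M\<^esub> x) = c \<odot>\<^bsub>N\<^esub> h x}"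

definition coord_space :: "(complex, complex ^ 'n) module" where
  "coord_space = mk_space UNIV 0 (+) (*s)"


subsection \<open>Direct limits of sequences\<close>

text \<open>
  For a sequence \<open>f i : M i \<rightarrow> M (i + 1)\<close> of linear maps, the composite
  \<open>M i \<rightarrow> M k\<close> (for \<open>i \<le> k\<close>) is \<open>fold f [i..<k]\<close>. The direct limit consists of the classes
  of pairs \<open>(i, x)\<close> with \<open>x\<close> in \<open>M i\<close>, two pairs being identified when their images agree
  at some later stage.
\<close>

definition dirlim_rel ::
  "(nat \<Rightarrow> (complex, 'b) module) \<Rightarrow> (nat \<Rightarrow> 'b \<Rightarrow> 'b) \<Rightarrow> ((nat \<times> 'b) \<times> (nat \<times> 'b)) set" where
  "dirlim_rel M f =
     {((i, x), (j, y)). x \<in> carrier (M i) \<and> y \<in> carrier (M j) \<and>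
        (\<exists>k. i \<le> k \<and> j \<le> k \<and> fold f [i..<k] x = fold f [j..<k] y)}"

definition dirlim_in ::
  "(nat \<Rightarrow> (complex, 'b) module) \<Rightarrow> (nat \<Rightarrow> 'b \<Rightarrow> 'b) \<Rightarrow> nat \<Rightarrow> 'b \<Rightarrow> (nat \<times> 'b) set" where
  "dirlim_in M f i x = dirlim_rel M f `` {(i, x)}"

definition dirlim ::
  "(nat \<Rightarrow> (complex, 'b) module) \<Rightarrow> (nat \<Rightarrow> 'b \<Rightarrow> 'b) \<Rightarrow> (complex, (nat \<times> 'b) set) module" where
  "dirlim M f =
     mk_space ((SIGMA i : UNIV. carrier (M i)) // dirlim_rel M f)
       (dirlim_in M f 0 (zero (M 0)))
       (\<lambda>X Y. \<Union>(i, x)\<in>X. \<Union>(j, y)\<in>Y.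
          dirlim_in M f (max i j)
            (fold f [i..<max i j] x \<oplus>\<^bsub>M (max i j)\<^esub> fold f [j..<max i j] y))
       (\<lambda>c X. \<Union>(i, x)\<in>X. dirlim_in M f i (c \<odot>\<^bsub>M i\<^esub> x))"


section \<open>Cyclic cohomology\<close>

text \<open>
  Throughout, \<open>'a\<close> is a complex algebra with scalar multiplication \<open>s\<close>. An \<open>(n+1)\<close>-linear
  functional is a function on lists of length \<open>n + 1\<close>, extended by \<open>0\<close> to all other lists.
\<close>

abbreviation lin_functional ::
  "(complex \<Rightarrow> 'a::ring_1 \<Rightarrow> 'a) \<Rightarrow> ('a \<Rightarrow> complex) \<Rightarrow> bool" where
  "lin_functional s \<equiv> Vector_Spaces.linear s (*)"

definition cochains :: "(complex \<Rightarrow> 'a::ring_1 \<Rightarrow> 'a) \<Rightarrow> nat \<Rightarrow> ('a list \<Rightarrow> complex) set" where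
  "cochains s n =
     {\<phi>. (\<forall>xs. length xs \<noteq> n + 1 \<longrightarrow> \<phi> xs = 0) \<and>
         (\<forall>xs i. length xs = n + 1 \<and> i < n + 1 \<longrightarrow>
            lin_functional s (\<lambda>x. \<phi> (xs[i := x])))}"

definition cyclic_cochains :: "(complex \<Rightarrow> 'a::ring_1 \<Rightarrow> 'a) \<Rightarrow> nat \<Rightarrow> ('a list \<Rightarrow> complex) set" where
  "cyclic_cochains s n =
     {\<phi> \<in> cochains s n. \<forall>xs. length xs = n + 1 \<longrightarrow> \<phi> (rotate1 xs) = (-1) ^ n * \<phi> xs}"

text \<open>\<open>merge i [a\<^sub>0, \<dots>, a\<^sub>m] = [a\<^sub>0, \<dots>, a\<^sub>i a\<^sub>i\<^sub>+\<^sub>1, \<dots>, a\<^sub>m]\<close> for \<open>i < m\<close>\<close>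

definition merge :: "nat \<Rightarrow> 'a::ring_1 list \<Rightarrow> 'a list" where
  "merge i xs = take i xs @ (xs ! i * xs ! Suc i) # drop (i + 2) xs"

definition hochschild_b :: "nat \<Rightarrow> ('a::ring_1 list \<Rightarrow> complex) \<Rightarrow> 'a list \<Rightarrow> complex" where
  "hochschild_b n \<phi> xs =
     (if length xs = n + 2
      then (\<Sum>i\<le>n. (-1) ^ i * \<phi> (merge i xs))
           + (-1) ^ (n + 1) * \<phi> ((last xs * hd xs) # tl (butlast xs))
      else 0)"

definition cyclic_cocycles :: "(complex \<Rightarrow> 'a::ring_1 \<Rightarrow> 'a) \<Rightarrow> nat \<Rightarrow> ('a list \<Rightarrow> complex) set" where
  "cyclic_cocycles s n = {\<phi> \<in> cyclic_cochains s n. hochschild_b n \<phi> = (\<lambda>_. 0)}"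

definition cyclic_coboundaries :: "(complex \<Rightarrow> 'a::ring_1 \<Rightarrow> 'a) \<Rightarrow> nat \<Rightarrow> ('a list \<Rightarrow> complex) set" where
  "cyclic_coboundaries s n =
     (case n of 0 \<Rightarrow> {\<lambda>_. 0} | Suc m \<Rightarrow> hochschild_b m ` cyclic_cochains s m)"

definition cocycle_space :: "(complex \<Rightarrow> 'a::ring_1 \<Rightarrow> 'a) \<Rightarrow> nat \<Rightarrow> (complex, 'a list \<Rightarrow> complex) module" where
  "cocycle_space s n =
     mk_space (cyclic_cocycles s n) (\<lambda>_. 0) (\<lambda>\<phi> \<psi> xs. \<phi> xs + \<psi> xs) (\<lambda>c \<phi> xs. c * \<phi> xs)"

definition HC :: "(complex \<Rightarrow> 'a::ring_1 \<Rightarrow> 'a) \<Rightarrow> nat \<Rightarrow> (complex, ('a list \<Rightarrow> complex) set) module" where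
  "HC s n = quot_space (cocycle_space s n) (cyclic_coboundaries s n)"

definition HC_class :: "(complex \<Rightarrow> 'a::ring_1 \<Rightarrow> 'a) \<Rightarrow> nat \<Rightarrow> ('a list \<Rightarrow> complex) \<Rightarrow> ('a list \<Rightarrow> complex) set" where
  "HC_class s n \<phi> = cyclic_coboundaries s n +>\<^bsub>cocycle_space s n\<^esub> \<phi>"

text \<open>
  Connes' periodicity operator is the cup product with the cyclic 2-cocycle \<open>\<sigma>\<close> on the complex
  numbers given by \<open>\<sigma>(1,1,1) = 1\<close>. On a cyclic \<open>n\<close>-cocycle \<open>\<phi>\<close>, with associated closed graded
  trace \<open>\<phi>'(a\<^sub>0 da\<^sub>1 \<dots> da\<^sub>n) = \<phi>(a\<^sub>0, \<dots>, a\<^sub>n)\<close> on universal differential forms,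
  \[(S\varphi)(a_0,\dots,a_{n+2}) = \sum_{i=1}^{n+1}
      \varphi'(a_0\,da_1 \cdots da_{i-1}\,(a_i a_{i+1})\,da_{i+2}\cdots da_{n+2}).\]
  Moving \<open>a\<^sub>i a\<^sub>i\<^sub>+\<^sub>1\<close> to the left with \<open>(da) b = d(ab) - a db\<close> turns the \<open>i\<close>-th summand into
  \[\sum_{j<i} (-1)^{i-1-j}\,
      \varphi(a_0,\dots,a_j a_{j+1},\dots,a_i a_{i+1},\dots,a_{n+2}),\]
  where for \<open>j = i - 1\<close> the combined entry is \<open>a\<^sub>i\<^sub>-\<^sub>1 a\<^sub>i a\<^sub>i\<^sub>+\<^sub>1\<close>.
  Rescaling \<open>\<sigma>\<close> (some authors use \<open>2\<pi>i\<close>) does not affect the direct limit up to isomorphism, nor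
  the subspace spanned by given classes of degree 0.
\<close>

definition connes_S :: "nat \<Rightarrow> ('a::ring_1 list \<Rightarrow> complex) \<Rightarrow> 'a list \<Rightarrow> complex" where
  "connes_S n \<phi> xs =
     (if length xs = n + 3
      then (\<Sum>i = 1..n + 1. \<Sum>j<i. (-1) ^ (i - 1 - j) * \<phi> (merge j (merge i xs)))
      else 0)"

definition HC_S :: "(complex \<Rightarrow> 'a::ring_1 \<Rightarrow> 'a) \<Rightarrow> nat \<Rightarrow> ('a list \<Rightarrow> complex) set \<Rightarrow> ('a list \<Rightarrow> complex) set" where
  "HC_S s n X = (\<Union>\<phi>\<in>X. HC_class s (n + 2) (connes_S n \<phi>))"

definition HC_even :: "(complex \<Rightarrow> 'a::ring_1 \<Rightarrow> 'a) \<Rightarrow> (complex, (nat \<times> ('a list \<Rightarrow> complex) set) set) module" where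
  "HC_even s = dirlim (\<lambda>n. HC s (2 * n)) (\<lambda>n. HC_S s (2 * n))"

definition cyclic_0_cocycle :: "(complex \<Rightarrow> 'a::ring_1 \<Rightarrow> 'a) \<Rightarrow> ('a \<Rightarrow> complex) \<Rightarrow> bool" where
  "cyclic_0_cocycle s \<psi> \<longleftrightarrow> lin_functional s \<psi> \<and> (\<forall>x y. \<psi> (x * y) = \<psi> (y * x))"

definition cochain_of :: "('a \<Rightarrow> complex) \<Rightarrow> 'a list \<Rightarrow> complex" where
  "cochain_of \<psi> xs = (case xs of [x] \<Rightarrow> \<psi> x | _ \<Rightarrow> 0)"

lemma cochain_of_cocycle_iff:
  "cochain_of \<psi> \<in> cyclic_cocycles s 0 \<longleftrightarrow> cyclic_0_cocycle s \<psi>"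
proof -
  have c: "cochain_of \<psi> \<in> cyclic_cochains s 0 \<longleftrightarrow> lin_functional s \<psi>"
    by (auto simp: cyclic_cochains_def cochains_def cochain_of_def length_Suc_conv
        split: list.splits)
  have b: "hochschild_b 0 (cochain_of \<psi>) xs
             = (case xs of [x, y] \<Rightarrow> \<psi> (x * y) - \<psi> (y * x) | _ \<Rightarrow> 0)" for xs
    by (auto simp: hochschild_b_def merge_def cochain_of_def split: list.splits)
  have "hochschild_b 0 (cochain_of \<psi>) = (\<lambda>_. 0) \<longleftrightarrow> (\<forall>x y. \<psi> (x * y) = \<psi> (y * x))"
  proof
    assume h: "hochschild_b 0 (cochain_of \<psi>) = (\<lambda>_. 0)"
    show "\<forall>x y. \<psi> (x * y) = \<psi> (y * x)"
    proof (intro allI)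
      fix x y
      show "\<psi> (x * y) = \<psi> (y * x)"
        using fun_cong[OF h, of "[x, y]"] unfolding b by simp
    qed
  next
    assume "\<forall>x y. \<psi> (x * y) = \<psi> (y * x)"
    then show "hochschild_b 0 (cochain_of \<psi>) = (\<lambda>_. 0)"
      by (auto simp: fun_eq_iff b split: list.splits)
  qed
  with c show ?thesis
    by (simp add: cyclic_cocycles_def cyclic_0_cocycle_def)
qed

definition HC_even_class ::
  "(complex \<Rightarrow> 'a::ring_1 \<Rightarrow> 'a) \<Rightarrow> ('a \<Rightarrow> complex) \<Rightarrow> (nat \<times> ('a list \<Rightarrow> complex) set) set" where
  "HC_even_class s \<psi> =
     dirlim_in (\<lambda>n. HC s (2 * n)) (\<lambda>n. HC_S s (2 * n)) 0 (HC_class s 0 (cochain_of \<psi>))"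


section \<open>The infinite dihedral group and its group algebra\<close>

text \<open>
  \<open>Dih m False\<close> stands for \<open>S\<^sup>m\<close> and \<open>Dih m True\<close> for \<open>S\<^sup>m e\<close>. The (non-commutative) group law
  is written additively, because \<open>'g \<Rightarrow>\<^sub>0 complex\<close> carries the convolution product, i.e. is the
  group algebra, for \<open>'g\<close> of class \<^class>\<open>monoid_add\<close>.
\<close>

datatype dihedral = Dih (rot: int) (flip: bool)

instantiation dihedral :: group_add
begin

definition "0 = Dih 0 False"
definition "g + h = Dih (rot g + (if flip g then - rot h else rot h)) (flip g \<noteq> flip h)"
definition "- g = Dih (if flip g then rot g else - rot g) (flip g)"
definition "g - h = g + - (h :: dihedral)"

instance
  by standard
    (auto simp: zero_dihedral_def plus_dihedral_def uminus_dihedral_def minus_dihedral_def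
       dihedral.expand)

end

definition dih_S :: dihedral where "dih_S = Dih 1 False"
definition dih_e :: dihedral where "dih_e = Dih 0 True"

lemma dihedral_relations:
  "dih_e + dih_e = 0" "dih_e + dih_S + dih_e = - dih_S"
  by (simp_all add: dih_S_def dih_e_def zero_dihedral_def plus_dihedral_def uminus_dihedral_def)

lemma dihedral_normal_form:
  "Dih (int n) False = (((+) dih_S) ^^ n) 0"
  "Dih (- int n) False = (((+) (- dih_S)) ^^ n) 0"
  "Dih m True = Dih m False + dih_e"
proof -
  show "Dih (int n) False = (((+) dih_S) ^^ n) 0"
  proof (induction n)
    case (Suc n)
    show ?case
      unfolding funpow.simps o_apply Suc[symmetric] by (simp add: dih_S_def plus_dihedral_def)
  qed (simp add: zero_dihedral_def)
  show "Dih (- int n) False = (((+) (- dih_S)) ^^ n) 0"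
  proof (induction n)
    case (Suc n)
    show ?case
      unfolding funpow.simps o_apply Suc[symmetric]
      by (simp add: dih_S_def plus_dihedral_def uminus_dihedral_def)
  qed (simp add: zero_dihedral_def)
qed (simp add: dih_e_def plus_dihedral_def)

definition grp_scale :: "complex \<Rightarrow> ('g \<Rightarrow>\<^sub>0 complex) \<Rightarrow> ('g \<Rightarrow>\<^sub>0 complex)" where
  "grp_scale c = Poly_Mapping.map ((*) c)"

lemma lookup_grp_scale: "Poly_Mapping.lookup (grp_scale c x) g = c * Poly_Mapping.lookup x g"
  by (simp add: grp_scale_def map.rep_eq when_def)

lemma vector_space_grp_scale: "vector_space grp_scale"
  by standard
    (auto intro!: poly_mapping_eqI simp: lookup_grp_scale lookup_add algebra_simps)

abbreviation grp_elem :: "'g \<Rightarrow> ('g \<Rightarrow>\<^sub>0 complex)" where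
  "grp_elem g \<equiv> Poly_Mapping.single g 1"

end

theory Submission
  imports Defs "HOL-Analysis.Cartesian_Space"
begin

text \<open>
  Write \<open>\<Gamma>\<close> for the infinite dihedral group and \<open>A\<close> for its group algebra. A trace is a cyclic
  0-cocycle. The proof has three parts.

  Every class comes from a trace. The group \<open>\<Gamma>\<close> is the free product of the groups of order two
  generated by \<open>e\<close> and \<open>S e\<close>, so its Cayley graph is a tree, in fact a line. Summing along paths
  in this graph gives a derivation \<open>A \<rightarrow> A \<otimes> A \<otimes> A\<close> that lifts the universal one, and from it a
  homotopy which kills the Hochschild cohomology of \<open>A\<close> in all degrees \<open>\<ge> 2\<close>
  (\<open>hochschild_vanishing\<close>). A cyclic cocycle of degree \<open>\<ge> 2\<close> is therefore a Hochschild
  coboundary, and by the exactness of Connes' sequence its class is in the image of the periodicity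
  operator \<open>S\<close> (\<open>connes_S_onto\<close>). Descending to degree zero, one finds that the direct limit
  consists of the classes of traces (\<open>HC_even_generated_by_traces\<close>).

  Only three values of a trace matter. A trace is a function on the conjugacy classes, which are
  \<open>{1}\<close>, the reflections \<open>S\<^sup>m e\<close> with \<open>m\<close> even, those with \<open>m\<close> odd, and
  \<open>{S\<^sup>m, S\<^sup>-\<^sup>m}\<close> for \<open>m > 0\<close>. If it vanishes on the elements of finite order, then \<open>S\<close> takes it
  to an explicit coboundary built from the exponent of \<open>S\<close> (\<open>connes_S_trace_coboundary\<close>), so its
  class in the limit is zero. Hence the class of a trace is determined by its values at \<open>1\<close>,
  \<open>e\<close> and \<open>S e\<close>, and \<open>\<psi>\<^sub>0, \<psi>\<^sub>1, \<psi>\<^sub>2\<close> generate.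

  These values are invariants of the class. For an idempotent \<open>p\<close>, the number \<open>\<phi>(p, \<dots>, p)\<close>
  is zero for a coboundary \<open>\<phi>\<close>, and \<open>S\<close> multiplies it by a nonzero factor, so the value of a trace
  at \<open>p\<close> depends only on its class in the limit (\<open>HC_even_class_idempotent\<close>). The idempotents
  \<open>1\<close>, \<open>(1 + e) / 2\<close> and \<open>(1 + S e) / 2\<close> separate the combinations of
  \<open>\<psi>\<^sub>0, \<psi>\<^sub>1, \<psi>\<^sub>2\<close>.

  Everything about \<open>S\<close> rests on one formula. If \<open>e\<^sub>i\<close> is the \<open>i\<close>-th signed face operator, so that
  the Hochschild coboundary is \<open>b = \<Sum>\<^sub>i e\<^sub>i\<close>, then \<open>S \<phi> = - b (\<Sum>\<^sub>i i e\<^sub>i \<phi>)\<close> for every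
  cocycle \<open>\<phi>\<close> (\<open>connes_S_weighted_b\<close>), while the cyclic operator shifts the index of \<open>e\<^sub>i\<close>.
  That \<open>S\<close> preserves cyclic cocycles and coboundaries, and the exactness above, then follow by
  formal computation.
\<close>

section \<open>Faces of tuples\<close>

text \<open>
  The \<open>n + 1\<close> faces of an \<open>(n + 1)\<close>-tuple in the cyclic order: \<open>face n\<close>
  multiplies the last entry with the first. With this last face included, the faces satisfy the
  simplicial identities (\<open>face_face\<close>) and are permuted by rotation (\<open>face_rotate1\<close>).
\<close>

definition face :: "nat \<Rightarrow> 'a::ring_1 list \<Rightarrow> 'a list" where
  "face i xs =
     (if Suc i < length xs then merge i xs else (last xs * hd xs) # tl (butlast xs))"

lemma length_face: "2 \<le> length xs \<Longrightarrow> length (face i xs) = length xs - 1"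
  by (auto simp: face_def merge_def)

lemma nth_face:
  assumes "length xs = Suc m" "0 < m" "i \<le> m" "k < m"
  shows "face i xs ! k =
    (if i < m then if k < i then xs ! k else if k = i then xs ! i * xs ! Suc i else xs ! Suc k
     else if k = 0 then xs ! m * xs ! 0 else xs ! k)"
proof (cases "i < m")
  case True
  have "Suc (Suc (i + (k - i - 1))) = Suc k" if "i < k" using that by simp
  then show ?thesis
    using assms True by (auto simp: face_def merge_def nth_append min_def nth_Cons')
next
  case False
  then have "i = m" using assms by simp
  moreover have "xs \<noteq> []" using assms by auto
  ultimately show ?thesis
    using assms by (auto simp: face_def nth_Cons last_conv_nth hd_conv_nth nth_tl nth_butlast split: nat.split)
qed

lemma face_face:
  assumes "length xs = m + 2" "0 < m" "j < i" "i \<le> m + 1"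
  shows "face j (face i xs) = face (i - 1) (face j xs)"
proof (rule nth_equalityI)
  have l: "length (face k xs) = Suc m" for k
    using assms by (simp add: length_face)
  show "length (face j (face i xs)) = length (face (i - 1) (face j xs))"
    using assms by (simp add: l length_face)
  fix k assume "k < length (face j (face i xs))"
  then have k: "k < m" using assms by (simp add: l length_face)
  have xs: "length xs = Suc (Suc m)" using assms by simp
  show "face j (face i xs) ! k = face (i - 1) (face j xs) ! k"
  proof (cases "i = Suc m")
    case True
    have fi: "face (Suc m) xs ! l = (if l = 0 then xs ! Suc m * xs ! 0 else xs ! l)" if "l \<le> m" for l
      using that True nth_face[OF xs, of "Suc m" l] by simp
    have fj: "face j xs ! l = (if l < j then xs ! l else if l = j then xs ! j * xs ! Suc j else xs ! Suc l)"
      if "l \<le> m" for l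
      using that True assms nth_face[OF xs, of j l] by simp
    have "face (i - 1) (face j xs) ! k = (if k = 0 then face j xs ! m * face j xs ! 0 else face j xs ! k)"
      using True k nth_face[OF l, of m k] by simp
    moreover have "face j (face (Suc m) xs) ! k =
        (if j < m then if k < j then face (Suc m) xs ! k else if k = j then face (Suc m) xs ! j * face (Suc m) xs ! Suc j
           else face (Suc m) xs ! Suc k
         else if k = 0 then face (Suc m) xs ! m * face (Suc m) xs ! 0 else face (Suc m) xs ! k)"
      using True assms k nth_face[OF l, of j k "Suc m"] by simp
    ultimately show ?thesis
      using True assms k by (simp add: fi fj mult.assoc) (auto simp: less_Suc_eq)
  next
    case False
    define p where "p = i - 1"
    have ip: "i = Suc p" and p: "j \<le> p" "p < m" using assms False by (auto simp: p_def)
    have fi: "face i xs ! l = (if l \<le> p then xs ! l else if l = Suc p then xs ! Suc p * xs ! Suc (Suc p) else xs ! Suc l)"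
      if "l \<le> m" for l
      using that p ip nth_face[OF xs, of i l] by (auto simp: less_Suc_eq_le)
    have fj: "face j xs ! l = (if l < j then xs ! l else if l = j then xs ! j * xs ! Suc j else xs ! Suc l)"
      if "l \<le> m" for l
      using that p nth_face[OF xs, of j l] by simp
    have "face j (face i xs) ! k =
        (if k < j then face i xs ! k else if k = j then face i xs ! j * face i xs ! Suc j else face i xs ! Suc k)"
      using p k by (simp add: nth_face[OF l])
    moreover have "face (i - 1) (face j xs) ! k =
        (if k < p then face j xs ! k else if k = p then face j xs ! p * face j xs ! Suc p else face j xs ! Suc k)"
      using p k ip by (simp add: nth_face[OF l])
    moreover consider "k < j" | "k = j" "j = p" | "k = j" "j < p" | "j < k" "k < p" | "j < k" "k = p" | "p < k"
      using p by linarith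
    ultimately show ?thesis
      using p k by cases (simp_all add: fi fj mult.assoc)
  qed
qed

lemma face_rotate1:
  assumes "length xs = m + 2" "i \<le> m + 1"
  shows "face i (rotate1 xs) = (if i = m + 1 then face 0 xs else rotate1 (face (Suc i) xs))"
proof (rule nth_equalityI)
  have xs: "length xs = Suc (Suc m)" using assms by simp
  have rxs: "length (rotate1 xs) = Suc (Suc m)" using assms by simp
  have l: "length (face k xs) = Suc m" for k
    using assms by (simp add: length_face)
  have r: "rotate1 ys ! k = ys ! (if Suc k = length ys then 0 else Suc k)"
    if "k < length ys" for ys :: "'a list" and k
    using that by (simp add: nth_rotate1 mod_Suc)
  show "length (face i (rotate1 xs)) = length (if i = m + 1 then face 0 xs else rotate1 (face (Suc i) xs))"
    using assms by (simp add: length_face)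
  fix k assume "k < length (face i (rotate1 xs))"
  then have k: "k < Suc m" using assms by (simp add: length_face)
  have rx: "rotate1 xs ! j = xs ! (if j = Suc m then 0 else Suc j)" if "j < Suc (Suc m)" for j
    using r[of j xs] that xs by simp
  have rf: "rotate1 (face j xs) ! k = face j xs ! (if k = m then 0 else Suc k)" for j
    using r[of k "face j xs"] k l by simp
  show "face i (rotate1 xs) ! k = (if i = m + 1 then face 0 xs else rotate1 (face (Suc i) xs)) ! k"
  proof (cases "i = m + 1")
    case True
    then show ?thesis
      using k by (simp add: nth_face[OF rxs] nth_face[OF xs] rx)
  next
    case False
    then have "i \<le> m" using assms by simp
    then show ?thesis
      using k False by (auto simp: rf nth_face[OF rxs] nth_face[OF xs] rx)
  qed
qed

lemma hochschild_b_face: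
  "length xs = n + 2 \<Longrightarrow> hochschild_b n \<phi> xs = (\<Sum>i\<le>n + 1. (-1) ^ i * \<phi> (face i xs))"
  by (simp add: hochschild_b_def face_def lessThan_Suc_atMost)

text \<open>
  The simplicial identities match each pair \<open>(i, j)\<close> with \<open>i \<le> j\<close> to the pair
  \<open>(j + 1, i)\<close> below the diagonal. Weight \<open>1\<close> gives \<open>b\<^sup>2 = 0\<close>, and other weights express the periodicity operator
  as a coboundary.
\<close>

lemma simplicial_sum:
  fixes E g :: "nat \<Rightarrow> nat \<Rightarrow> complex"
  assumes E: "\<And>i j. i \<le> j \<Longrightarrow> j \<le> m \<Longrightarrow> E i j = - E (Suc j) i"
  shows "(\<Sum>i\<le>Suc m. \<Sum>j\<le>m. g i j * E i j) =
    (\<Sum>i\<le>Suc m. \<Sum>j<i. (g i j - g j (i - 1)) * E i j)"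
proof -
  have "(\<Sum>i\<le>Suc m. \<Sum>j\<le>m. g i j * E i j) =
      (\<Sum>i\<le>Suc m. \<Sum>j<i. g i j * E i j) + (\<Sum>i\<le>Suc m. \<Sum>j\<in>{i..m}. g i j * E i j)"
    unfolding sum.distrib[symmetric]
  proof (rule sum.cong[OF refl])
    fix i assume "i \<in> {..Suc m}"
    then have "{..m} = {..<i} \<union> {i..m}" by auto
    then show "(\<Sum>j\<le>m. g i j * E i j) = (\<Sum>j<i. g i j * E i j) + (\<Sum>j\<in>{i..m}. g i j * E i j)"
      by (simp only:) (rule sum.union_disjoint; auto)
  qed
  also have "(\<Sum>i\<le>Suc m. \<Sum>j\<in>{i..m}. g i j * E i j) =
      - (\<Sum>i\<le>Suc m. \<Sum>j\<in>{i..m}. g i j * E (Suc j) i)"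
    unfolding sum_negf[symmetric] by (intro sum.cong refl) (simp add: E)
  also have "(\<Sum>i\<le>Suc m. \<Sum>j\<in>{i..m}. g i j * E (Suc j) i) =
      (\<Sum>i\<le>Suc m. \<Sum>j<i. g j (i - 1) * E i j)"
    unfolding sum.Sigma[OF finite_atMost ballI[OF finite_atLeastAtMost]]
      sum.Sigma[OF finite_atMost ballI[OF finite_lessThan]]
    by (rule sum.reindex_bij_witness[where i = "\<lambda>(i, j). (j, i - 1)" and j = "\<lambda>(i, j). (Suc j, i)"])
      auto
  finally show ?thesis
    by (simp add: sum_subtractf left_diff_distrib)
qed

section \<open>The Hochschild coboundary and the cyclic operator\<close>

text \<open>
  With \<open>e\<^sub>i \<phi>\<close> the pullback of \<open>\<phi>\<close> along the \<open>i\<close>-th face, with sign \<open>(-1)\<^sup>i\<close>, the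
  coboundary is \<open>b = \<Sum>\<^sub>i e\<^sub>i\<close> and \<open>tail_b\<close> is \<open>b - e\<^sub>0\<close>. The latter is the bar
  differential, usually written \<open>b'\<close>, up to a rotation of the arguments.
\<close>

definition tail_b :: "nat \<Rightarrow> ('a::ring_1 list \<Rightarrow> complex) \<Rightarrow> 'a list \<Rightarrow> complex" where
  "tail_b n \<phi> xs =
     (if length xs = n + 2 then \<Sum>i\<le>n. (-1) ^ Suc i * \<phi> (face (Suc i) xs) else 0)"

text \<open>
  The cochain \<open>\<Sum>\<^sub>i i e\<^sub>i \<phi>\<close>. It links two descriptions of periodicity: its coboundary is
  \<open>- S \<phi>\<close> for a cocycle \<open>\<phi>\<close>, and applying \<open>1 - T\<close> to it yields a multiple of
  \<open>tail_b \<phi>\<close> for a cyclic cocycle \<open>\<phi>\<close>, where \<open>T\<close> is the cyclic operator \<open>cyc\<close>. So it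
  solves the zig-zag in the cyclic bicomplex that defines \<open>S\<close>.
\<close>

definition weighted_b :: "nat \<Rightarrow> ('a::ring_1 list \<Rightarrow> complex) \<Rightarrow> 'a list \<Rightarrow> complex" where
  "weighted_b n \<phi> xs =
     (if length xs = n + 2 then \<Sum>i\<le>n + 1. of_nat i * (-1) ^ i * \<phi> (face i xs) else 0)"

definition cyc :: "nat \<Rightarrow> ('a list \<Rightarrow> complex) \<Rightarrow> 'a list \<Rightarrow> complex" where
  "cyc n \<phi> xs = (-1) ^ n * \<phi> (rotate1 xs)"

lemma hochschild_b_tail:
  "length xs = n + 2 \<Longrightarrow> hochschild_b n \<phi> xs = \<phi> (face 0 xs) + tail_b n \<phi> xs"
  by (simp add: hochschild_b_face tail_b_def sum.atMost_Suc_shift del: sum.atMost_Suc)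

lemma double_face:
  assumes "length xs = n + 3" "i \<le> j" "j \<le> n + 1"
  shows "(-1) ^ (i + j) * \<phi> (face j (face i xs)) =
    - ((-1) ^ (Suc j + i) * (\<phi> (face i (face (Suc j) xs)) :: complex))"
proof -
  have "face j (face i xs) = face i (face (Suc j) xs)"
    using face_face[of xs "n + 1" i "Suc j"] assms by simp
  then show ?thesis by (simp add: add.commute)
qed

lemma b_b: "hochschild_b (Suc n) (hochschild_b n \<phi>) = (\<lambda>_. 0)"
proof
  fix xs :: "'a list"
  show "hochschild_b (Suc n) (hochschild_b n \<phi>) xs = 0"
  proof (cases "length xs = n + 3")
    case True
    define E where "E i j = (-1) ^ (i + j) * \<phi> (face j (face i xs))" for i j
    have "hochschild_b (Suc n) (hochschild_b n \<phi>) xs =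
        (\<Sum>i\<le>Suc (n + 1). \<Sum>j\<le>n + 1. 1 * E i j)"
      using True
      by (simp add: hochschild_b_face length_face sum_distrib_left E_def power_add mult_ac
          del: sum.atMost_Suc)
    also have "\<dots> = 0"
      by (subst simplicial_sum) (use double_face[OF True] in \<open>auto simp: E_def\<close>)
    finally show ?thesis .
  qed (simp add: hochschild_b_def)
qed

lemma tail_b_tail_b: "tail_b (Suc n) (tail_b n \<phi>) = (\<lambda>_. 0)"
proof
  fix xs :: "'a list"
  show "tail_b (Suc n) (tail_b n \<phi>) xs = 0"
  proof (cases "length xs = n + 3")
    case True
    define E where "E i j = (-1) ^ (Suc i + Suc j) * \<phi> (face (Suc j) (face (Suc i) xs))" for i j
    have "tail_b (Suc n) (tail_b n \<phi>) xs = (\<Sum>i\<le>Suc n. \<Sum>j\<le>n. 1 * E i j)"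
      using True
      by (simp add: tail_b_def length_face sum_distrib_left E_def power_add mult_ac
          del: sum.atMost_Suc)
    also have "\<dots> = 0"
      by (subst simplicial_sum) (use double_face[OF True, of "Suc _" "Suc _"] in \<open>auto simp: E_def\<close>)
    finally show ?thesis .
  qed (simp add: tail_b_def)
qed

text \<open>
  \<open>(1 - T) b = (b - e\<^sub>0) (1 - T)\<close>, because \<open>T e\<^sub>i = e\<^sub>i\<^sub>+\<^sub>1 T\<close>, except that \<open>T\<close> takes
  the last \<open>e\<^sub>i\<close> to \<open>e\<^sub>0\<close>.
\<close>

lemma b_cyc:
  "hochschild_b n \<phi> xs - cyc (Suc n) (hochschild_b n \<phi>) xs =
    tail_b n \<phi> xs - tail_b n (cyc n \<phi>) xs"
proof (cases "length xs = n + 2")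
  case True
  then have "cyc (Suc n) (hochschild_b n \<phi>) xs =
      (\<Sum>i\<le>n. (-1) ^ Suc n * ((-1) ^ i * \<phi> (rotate1 (face (Suc i) xs)))) + \<phi> (face 0 xs)"
    by (simp add: cyc_def hochschild_b_face face_rotate1 distrib_left sum_distrib_left
        minus_one_power_iff)
  also have "(\<Sum>i\<le>n. (-1) ^ Suc n * ((-1) ^ i * \<phi> (rotate1 (face (Suc i) xs)))) =
      tail_b n (cyc n \<phi>) xs"
    using True by (simp add: tail_b_def cyc_def mult_ac)
  finally show ?thesis
    using True by (simp add: hochschild_b_tail)
qed (simp add: hochschild_b_def tail_b_def cyc_def)

text \<open>
  For cyclic \<open>\<phi>\<close> the operator \<open>T\<close> permutes the \<open>n + 2\<close> cochains \<open>e\<^sub>i \<phi>\<close> cyclically,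
  so \<open>(1 - T) \<Sum>\<^sub>i i e\<^sub>i \<phi> = b \<phi> - (n + 2) e\<^sub>0 \<phi>\<close>.
\<close>

lemma weighted_b_cyc:
  assumes cyc: "cyc n \<phi> = \<phi>"
  shows "weighted_b n \<phi> xs - cyc (Suc n) (weighted_b n \<phi>) xs =
    (of_nat n + 2) * tail_b n \<phi> xs - (of_nat n + 1) * hochschild_b n \<phi> xs"
proof (cases "length xs = n + 2")
  case True
  have r: "\<phi> (rotate1 ys) = (-1) ^ n * \<phi> ys" for ys
    using fun_cong[OF cyc, of ys, symmetric] by (simp add: cyc_def)
  have "cyc (Suc n) (weighted_b n \<phi>) xs =
      (\<Sum>i\<le>n. - (of_nat i * (-1) ^ i * \<phi> (face (Suc i) xs))) + (of_nat n + 1) * \<phi> (face 0 xs)"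
    using True
    by (simp add: cyc_def weighted_b_def face_rotate1 distrib_left sum_distrib_left r length_face
        sum_negf minus_one_power_iff algebra_simps)
  also have "(\<Sum>i\<le>n. - (of_nat i * (-1) ^ i * \<phi> (face (Suc i) xs))) =
     weighted_b n \<phi> xs - tail_b n \<phi> xs"
    using True
    by (simp add: weighted_b_def tail_b_def sum.atMost_Suc_shift sum_subtractf[symmetric]
        sum_negf[symmetric] algebra_simps del: sum.atMost_Suc)
  finally show ?thesis
    using True by (simp add: hochschild_b_tail algebra_simps)
qed (simp add: hochschild_b_def tail_b_def weighted_b_def cyc_def)

text \<open>
  Let \<open>E\<^sub>i\<^sub>j\<close> be the signed double faces. The coboundary of \<open>weighted_b \<phi>\<close> is
  \<open>\<Sum> j E\<^sub>i\<^sub>j\<close>, and adding \<open>i\<close> to the weight changes nothing since \<open>\<Sum>\<^sub>j E\<^sub>i\<^sub>j = 0\<close> for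
  a cocycle. With weight \<open>i + j\<close>, the simplicial identities leave each \<open>E\<^sub>i\<^sub>j\<close> with \<open>j < i\<close>
  with coefficient \<open>1\<close>. The row \<open>i = n + 2\<close> cancels once more by the cocycle condition, and what
  remains is the sum that defines \<open>- S \<phi>\<close>.
\<close>

lemma connes_S_weighted_b:
  assumes "hochschild_b n \<phi> = (\<lambda>_. 0)"
  shows "connes_S n \<phi> xs = - hochschild_b (Suc n) (weighted_b n \<phi>) xs"
proof (cases "length xs = n + 3")
  case True
  define E where "E i j = (-1) ^ (i + j) * \<phi> (face j (face i xs))" for i j
  have E: "E i j = - E (Suc j) i" if "i \<le> j" "j \<le> n + 1" for i j
    using double_face[OF True that] by (simp add: E_def)
  have R: "(\<Sum>j\<le>n + 1. E i j) = 0" for i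
  proof -
    have "(\<Sum>j\<le>n + 1. E i j) = (-1) ^ i * hochschild_b n \<phi> (face i xs)"
      using True by (simp add: E_def hochschild_b_face length_face sum_distrib_left power_add mult_ac
         del: sum.atMost_Suc)
    then show ?thesis by (simp add: assms)
  qed
  have "hochschild_b (Suc n) (weighted_b n \<phi>) xs = (\<Sum>i\<le>Suc (n + 1). \<Sum>j\<le>n + 1. of_nat j * E i j)"
    using True
    by (simp add: hochschild_b_face weighted_b_def length_face sum_distrib_left E_def power_add mult_ac
         del: sum.atMost_Suc)
  also have "\<dots> = (\<Sum>i\<le>Suc (n + 1). \<Sum>j\<le>n + 1. (of_nat i + of_nat j) * E i j)"
    using R by (simp add: distrib_right sum.distrib flip: sum_distrib_left del: sum.atMost_Suc)
  also have "\<dots> = (\<Sum>i\<le>Suc (n + 1). \<Sum>j<i. ((of_nat i + of_nat j) - (of_nat j + of_nat (i - 1))) * E i j)"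
    by (rule simplicial_sum[where g = "\<lambda>i j. of_nat i + of_nat j"]) (rule E)
  also have "\<dots> = (\<Sum>i\<le>Suc (n + 1). \<Sum>j<i. E i j)"
    by (intro sum.cong refl) (auto simp: of_nat_diff)
  also have "\<dots> = (\<Sum>i\<le>n + 1. \<Sum>j<i. E i j)"
    using R[of "n + 2"] by (simp add: lessThan_Suc_atMost)
  also have "\<dots> = (\<Sum>i = 1..n + 1. \<Sum>j<i. E i j)"
    by (rule sum.mono_neutral_right) (auto simp: Suc_le_eq)
  also have "\<dots> = - connes_S n \<phi> xs"
  proof -
    have "E i j = - ((-1) ^ (i - 1 - j) * \<phi> (merge j (merge i xs)))"
      if "1 \<le> i" "i \<le> n + 1" "j < i" for i j
    proof -
      have "(-1) ^ (i + j) = - ((-1) ^ (i - 1 - j) :: complex)"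
        using that by (simp add: minus_one_power_iff)
      moreover have "face i xs = merge i xs" using that True by (simp add: face_def)
      moreover have "length (merge i xs) = n + 2" using that True by (simp add: merge_def)
      ultimately show ?thesis using that by (simp add: E_def face_def)
    qed
    moreover have "connes_S n \<phi> xs =
        (\<Sum>i = 1..n + 1. \<Sum>j<i. (-1) ^ (i - 1 - j) * \<phi> (merge j (merge i xs)))"
      using True by (simp add: connes_S_def)
    ultimately show ?thesis
      by (simp only: sum_negf[symmetric]) (intro sum.cong refl, simp)
  qed
  finally show ?thesis by simp
qed (simp add: connes_S_def hochschild_b_def)

text \<open>
  Contracting homotopy for \<open>tail_b\<close>, whose complex is acyclic for every unital algebra. The unit
  goes into the second place: the zeroth face, which would merge it with the first entry, is missing
  from \<open>tail_b\<close>, so that only the first face removes it again.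
\<close>

definition insert_one :: "'a::ring_1 list \<Rightarrow> 'a list" where
  "insert_one xs = hd xs # 1 # tl xs"

lemma face_insert_one:
  assumes "length xs = m + 2" "0 < i" "i \<le> m + 1"
  shows "face 1 (insert_one xs) = xs" "face (Suc i) (insert_one xs) = insert_one (face i xs)"
proof -
  obtain x y ys where xs: "xs = x # y # ys" and ys: "length ys = m"
    using assms(1) by (auto simp: length_Suc_conv numeral_2_eq_2)
  show "face 1 (insert_one xs) = xs"
    by (simp add: face_def merge_def xs insert_one_def)
  obtain k where "i = Suc k" using assms by (cases i) auto
  then show "face (Suc i) (insert_one xs) = insert_one (face i xs)"
    using assms by (auto simp: face_def merge_def xs insert_one_def)
qed

lemma tail_b_insert_one:
  assumes "tail_b (Suc m) \<phi> = (\<lambda>_. 0)" "length xs = m + 2"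
  shows "\<phi> xs = - tail_b m (\<lambda>ys. \<phi> (insert_one ys)) xs"
proof -
  have l: "length (insert_one xs) = Suc m + 2" using assms by (simp add: insert_one_def)
  have "0 = tail_b (Suc m) \<phi> (insert_one xs)" by (simp add: assms)
  also have "\<dots> = - \<phi> xs + (\<Sum>i\<le>m. (-1) ^ Suc (Suc i) * \<phi> (insert_one (face (Suc i) xs)))"
    using l assms(2) by (simp add: tail_b_def sum.atMost_Suc_shift face_insert_one(2)
      face_insert_one(1)[where i = 1, simplified] del: sum.atMost_Suc)
  also have "\<dots> = - \<phi> xs - tail_b m (\<lambda>ys. \<phi> (insert_one ys)) xs"
    using assms(2) by (simp add: tail_b_def sum_negf)
  finally show ?thesis by (simp add: minus_equation_iff[of "\<phi> xs"])
qed


section \<open>Multilinear functionals\<close>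

locale complex_algebra = vector_space s for s :: "complex \<Rightarrow> 'a::ring_1 \<Rightarrow> 'a" +
  assumes mult_scale_left: "s c x * y = s c (x * y)"
    and mult_scale_right: "x * s c y = s c (x * y)"
begin

lemma lin_functional_iff:
  "lin_functional s f \<longleftrightarrow> (\<forall>x y. f (x + y) = f x + f y) \<and> (\<forall>c x. f (s c x) = c * f x)"
proof -
  have "vector_space ((*) :: complex \<Rightarrow> _)"
    by standard (simp_all add: algebra_simps)
  then show ?thesis
    using vector_space_axioms by (simp add: Vector_Spaces.linear_iff)
qed

lemma cochains_iff:
  "\<phi> \<in> cochains s n \<longleftrightarrow>
    (\<forall>xs. length xs \<noteq> n + 1 \<longrightarrow> \<phi> xs = 0) \<and>
    (\<forall>xs i x y. length xs = n + 1 \<and> i < n + 1 \<longrightarrow>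
       \<phi> (xs[i := x + y]) = \<phi> (xs[i := x]) + \<phi> (xs[i := y])) \<and>
    (\<forall>xs i c x. length xs = n + 1 \<and> i < n + 1 \<longrightarrow> \<phi> (xs[i := s c x]) = c * \<phi> (xs[i := x]))"
  unfolding cochains_def lin_functional_iff by blast

lemma cochain_eq_0: "\<phi> \<in> cochains s n \<Longrightarrow> length xs \<noteq> n + 1 \<Longrightarrow> \<phi> xs = 0"
  by (simp add: cochains_def)

lemma cyclic_cochains_iff: "\<phi> \<in> cyclic_cochains s n \<longleftrightarrow> \<phi> \<in> cochains s n \<and> cyc n \<phi> = \<phi>"
proof -
  have "cyc n \<phi> = \<phi> \<longleftrightarrow> (\<forall>xs. length xs = n + 1 \<longrightarrow> \<phi> (rotate1 xs) = (-1) ^ n * \<phi> xs)"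
    if "\<phi> \<in> cochains s n"
  proof -
    have "cyc n \<phi> xs = \<phi> xs \<longleftrightarrow> (length xs = n + 1 \<longrightarrow> \<phi> (rotate1 xs) = (-1) ^ n * \<phi> xs)" for xs
    proof -
      have "cyc n \<phi> xs = \<phi> xs \<longleftrightarrow> \<phi> (rotate1 xs) = (-1) ^ n * \<phi> xs"
        unfolding cyc_def by (metis left_minus_one_mult_self)
      then show ?thesis
        using cochain_eq_0[OF that] by (cases "length xs = n + 1") auto
    qed
    then show ?thesis by (auto simp: fun_eq_iff)
  qed
  then show ?thesis by (auto simp: cyclic_cochains_def)
qed

lemma cochains_comb:
  assumes "\<phi> \<in> cochains s n" "\<psi> \<in> cochains s n"
  shows "(\<lambda>xs. c * \<phi> xs + d * \<psi> xs) \<in> cochains s n"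
  using assms unfolding cochains_iff by (auto simp: algebra_simps)

lemma cochains_zero: "(\<lambda>_. 0) \<in> cochains s n"
  unfolding cochains_iff by simp

lemma cochains_scale: "\<phi> \<in> cochains s n \<Longrightarrow> (\<lambda>xs. c * \<phi> xs) \<in> cochains s n"
  using cochains_comb[of \<phi> n \<phi> c 0] by simp

lemma cochains_add:
  "\<phi> \<in> cochains s n \<Longrightarrow> \<psi> \<in> cochains s n \<Longrightarrow> (\<lambda>xs. \<phi> xs + \<psi> xs) \<in> cochains s n"
  using cochains_comb[of \<phi> n \<psi> 1 1] by simp

lemma cochains_sub:
  "\<phi> \<in> cochains s n \<Longrightarrow> \<psi> \<in> cochains s n \<Longrightarrow> (\<lambda>xs. \<phi> xs - \<psi> xs) \<in> cochains s n"
  using cochains_comb[of \<phi> n \<psi> 1 "-1"] by simp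

lemma cochains_sum:
  assumes "\<And>i. i \<in> I \<Longrightarrow> \<phi> i \<in> cochains s n"
  shows "(\<lambda>xs. \<Sum>i\<in>I. \<phi> i xs) \<in> cochains s n"
  using assms
proof (induction I rule: infinite_finite_induct)
  case (insert i I)
  then show ?case using cochains_add[of "\<phi> i" n "\<lambda>xs. \<Sum>i\<in>I. \<phi> i xs"] by simp
qed (simp_all add: cochains_zero)

text \<open>
  Cochains pull back along any map of tuples that is affected by a change of one entry only in one
  place, and there by left and right multiplication. Faces, rotations and the insertion of a unit are
  of this kind.
\<close>

lemma cochain_pullback:
  assumes \<phi>: "\<phi> \<in> cochains s n"
    and len: "\<And>xs. length xs = m + 1 \<Longrightarrow> length (F xs) = n + 1"
    and upd: "\<And>xs i. length xs = m + 1 \<Longrightarrow> i < m + 1 \<Longrightarrow>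
      \<exists>k<n + 1. \<exists>a b. \<forall>x. F (xs[i := x]) = (F xs)[k := a * x * b]"
  shows "(\<lambda>xs. if length xs = m + 1 then \<phi> (F xs) else 0) \<in> cochains s m"
  unfolding cochains_iff
proof (intro conjI allI impI)
  fix xs :: "'a list" and i x y c assume i: "length xs = m + 1 \<and> i < m + 1"
  then obtain k a b where k: "k < n + 1" and F: "\<And>x. F (xs[i := x]) = (F xs)[k := a * x * b]"
    using upd by blast
  have "\<phi> ((F xs)[k := a * (x + y) * b]) = \<phi> ((F xs)[k := a * x * b]) + \<phi> ((F xs)[k := a * y * b])"
    using \<phi> len i k unfolding cochains_iff by (simp add: distrib_left distrib_right)
  then show "(if length (xs[i := x + y]) = m + 1 then \<phi> (F (xs[i := x + y])) else 0) =
      (if length (xs[i := x]) = m + 1 then \<phi> (F (xs[i := x])) else 0) +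
      (if length (xs[i := y]) = m + 1 then \<phi> (F (xs[i := y])) else 0)"
    using i by (simp add: F)
  have "\<phi> ((F xs)[k := a * s c x * b]) = c * \<phi> ((F xs)[k := a * x * b])"
    using \<phi> len i k unfolding cochains_iff by (simp add: mult_scale_left mult_scale_right)
  then show "(if length (xs[i := s c x]) = m + 1 then \<phi> (F (xs[i := s c x])) else 0) =
      c * (if length (xs[i := x]) = m + 1 then \<phi> (F (xs[i := x])) else 0)"
    using i by (simp add: F)
qed simp

lemma cochain_face:
  assumes "\<phi> \<in> cochains s n" "j \<le> n + 1"
  shows "(\<lambda>xs. if length xs = n + 2 then \<phi> (face j xs) else 0) \<in> cochains s (Suc n)"
proof -
  have "\<exists>k<n + 1. \<exists>a b. \<forall>x. face j (xs[i := x]) = (face j xs)[k := a * x * b]"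
    if "length xs = Suc n + 1" "i < Suc n + 1" for xs :: "'a list" and i
  proof -
    have xs: "length xs = Suc (Suc n)" using that by simp
    define k where "k = (if j \<le> n then if i \<le> j then i else i - 1 else if i = n + 1 then 0 else i)"
    define a where "a = (if j \<le> n then if i = Suc j then xs ! j else 1 else if i = 0 then xs ! Suc n else 1)"
    define b where "b = (if j \<le> n then if i = j then xs ! Suc j else 1 else if i = n + 1 then xs ! 0 else 1)"
    have "face j (xs[i := x]) = (face j xs)[k := a * x * b]" for x
    proof (rule nth_equalityI)
      fix l assume "l < length (face j (xs[i := x]))"
      then have l: "l < Suc n" using xs by (simp add: length_face)
      have ux: "length (xs[i := x]) = Suc (Suc n)" using xs by simp
      have u: "xs[i := x] ! p = (if p = i then x else xs ! p)" for p
        using that by (simp add: nth_list_update)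
      have r: "(face j xs)[k := a * x * b] ! l = (if l = k then a * x * b else face j xs ! l)"
        using l xs by (simp add: nth_list_update length_face)
      show "face j (xs[i := x]) ! l = (face j xs)[k := a * x * b] ! l"
      proof (cases "j \<le> n")
        case True
        have fu: "face j (xs[i := x]) ! l =
            (if l < j then xs[i := x] ! l else if l = j then xs[i := x] ! j * xs[i := x] ! Suc j
             else xs[i := x] ! Suc l)"
          using l True nth_face[OF ux, of j l] by simp
        have fj: "face j xs ! l =
            (if l < j then xs ! l else if l = j then xs ! j * xs ! Suc j else xs ! Suc l)"
          using True l nth_face[OF xs, of j l] by simp
        have kab: "k = (if i \<le> j then i else i - 1)" "a = (if i = Suc j then xs ! j else 1)"
            "b = (if i = j then xs ! Suc j else 1)"
          using True by (simp_all add: k_def a_def b_def)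
        consider "i < j" | "i = j" | "i = Suc j" | "Suc j < i" by linarith
        then show ?thesis
        proof cases
          case 1
          then show ?thesis unfolding r unfolding fu fj kab using that by (simp add: u)
        next
          case 2
          then show ?thesis unfolding r unfolding fu fj kab using that by (simp add: u)
        next
          case 3
          then show ?thesis unfolding r unfolding fu fj kab using that by (simp add: u)
        next
          case 4
          then obtain p where "i = Suc p" "j < p" by (cases i) auto
          then show ?thesis unfolding r unfolding fu fj kab using that by (simp add: u)
        qed
      next
        case False
        then have j: "j = Suc n" using assms by simp
        have fu: "face j (xs[i := x]) ! l =
            (if l = 0 then xs[i := x] ! Suc n * xs[i := x] ! 0 else xs[i := x] ! l)"
          using j l nth_face[OF ux, of j l] by simp
        have fj: "face j xs ! l = (if l = 0 then xs ! Suc n * xs ! 0 else xs ! l)"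
          using j l nth_face[OF xs, of j l] by simp
        have kab: "k = (if i = Suc n then 0 else i)" "a = (if i = 0 then xs ! Suc n else 1)"
            "b = (if i = Suc n then xs ! 0 else 1)"
          using j by (simp_all add: k_def a_def b_def)
        show ?thesis
          unfolding r unfolding fu fj kab using that l by (auto simp: u)
      qed
    qed (use xs in \<open>simp add: length_face\<close>)
    moreover have "k < n + 1" using that assms(2) by (auto simp: k_def)
    ultimately show ?thesis by blast
  qed
  then show ?thesis
    using cochain_pullback[of \<phi> n "Suc n" "face j"] assms by (simp add: length_face)
qed

lemma cochain_rotate1:
  assumes "\<phi> \<in> cochains s n"
  shows "(\<lambda>xs. \<phi> (rotate1 xs)) \<in> cochains s n"
proof -
  have "\<exists>k<n + 1. \<exists>a b. \<forall>x. rotate1 (xs[i := x]) = (rotate1 xs)[k := a * x * b]"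
    if "length xs = n + 1" "i < n + 1" for xs :: "'a list" and i
  proof -
    obtain y ys where xs: "xs = y # ys" "length ys = n" using \<open>length xs = n + 1\<close> by (cases xs) auto
    show ?thesis
    proof (cases i)
      case 0
      then show ?thesis
        using xs by (intro exI[of _ n] exI[of _ 1] conjI) (auto simp: list_update_append)
    next
      case (Suc i')
      then show ?thesis
        using xs that by (intro exI[of _ i'] exI[of _ 1] conjI) (auto simp: list_update_append)
    qed
  qed
  then have "(\<lambda>xs. if length xs = n + 1 then \<phi> (rotate1 xs) else 0) \<in> cochains s n"
    using cochain_pullback[of \<phi> n n rotate1] assms by simp
  moreover have "(\<lambda>xs. if length xs = n + 1 then \<phi> (rotate1 xs) else 0) = (\<lambda>xs. \<phi> (rotate1 xs))"
    using cochain_eq_0[OF assms] by auto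
  ultimately show ?thesis by simp
qed

lemma cochain_rotate:
  "\<phi> \<in> cochains s n \<Longrightarrow> (\<lambda>xs. \<phi> (rotate k xs)) \<in> cochains s n"
proof (induction k)
  case (Suc k)
  then show ?case using cochain_rotate1[of "\<lambda>xs. \<phi> (rotate k xs)"]
    by (simp add: rotate1_rotate_swap)
qed simp

lemma cochain_insert_one:
  assumes "\<phi> \<in> cochains s (Suc n)"
  shows "(\<lambda>xs. if length xs = n + 1 then \<phi> (insert_one xs) else 0) \<in> cochains s n"
proof (rule cochain_pullback[OF assms])
  fix xs :: "'a list" and i assume *: "length xs = n + 1" "i < n + 1"
  then obtain y ys where xs: "xs = y # ys" "length ys = n" by (cases xs) auto
  show "\<exists>k<Suc n + 1. \<exists>a b. \<forall>x. insert_one (xs[i := x]) = (insert_one xs)[k := a * x * b]"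
  proof (cases i)
    case 0
    then show ?thesis
      using xs by (intro exI[of _ 0] exI[of _ 1] conjI) (auto simp: insert_one_def)
  next
    case (Suc i')
    then show ?thesis
      using xs * by (intro exI[of _ "Suc i"] exI[of _ 1] conjI) (auto simp: insert_one_def)
  qed
qed (simp add: insert_one_def)

lemma cochain_cyc: "\<phi> \<in> cochains s n \<Longrightarrow> cyc n \<phi> \<in> cochains s n"
  unfolding cyc_def by (intro cochains_scale cochain_rotate1)

lemma cochain_face_sum:
  assumes "\<phi> \<in> cochains s n" "\<And>i. i \<in> I \<Longrightarrow> f i \<le> n + 1"
  shows "(\<lambda>xs. if length xs = n + 2 then \<Sum>i\<in>I. c i * \<phi> (face (f i) xs) else 0) \<in> cochains s (Suc n)"
proof -
  have "(\<lambda>xs. \<Sum>i\<in>I. c i * (if length xs = n + 2 then \<phi> (face (f i) xs) else 0)) \<in> cochains s (Suc n)"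
    using assms by (intro cochains_sum cochains_scale cochain_face) auto
  also have "(\<lambda>xs. \<Sum>i\<in>I. c i * (if length xs = n + 2 then \<phi> (face (f i) xs) else 0)) =
      (\<lambda>xs. if length xs = n + 2 then \<Sum>i\<in>I. c i * \<phi> (face (f i) xs) else 0)"
    by auto
  finally show ?thesis .
qed

lemma cochain_b:
  assumes "\<phi> \<in> cochains s n"
  shows "hochschild_b n \<phi> \<in> cochains s (Suc n)"
proof -
  have "hochschild_b n \<phi> =
      (\<lambda>xs. if length xs = n + 2 then \<Sum>i\<le>n + 1. (-1) ^ i * \<phi> (face i xs) else 0)"
  proof
    fix xs
    show "hochschild_b n \<phi> xs =
        (if length xs = n + 2 then \<Sum>i\<le>n + 1. (-1) ^ i * \<phi> (face i xs) else 0)"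
    proof (cases "length xs = n + 2")
      case True
      then show ?thesis unfolding hochschild_b_face[OF True] by simp
    qed (simp add: hochschild_b_def)
  qed
  then show ?thesis
    using cochain_face_sum[of \<phi> n "{..n + 1}" "\<lambda>i. i" "\<lambda>i. (-1) ^ i"] assms by simp
qed

lemma cochain_weighted_b:
  assumes "\<phi> \<in> cochains s n"
  shows "weighted_b n \<phi> \<in> cochains s (Suc n)"
  using cochain_face_sum[of \<phi> n "{..n + 1}" "\<lambda>i. i" "\<lambda>i. of_nat i * (-1) ^ i"] assms
  unfolding weighted_b_def[abs_def] by simp

end

section \<open>The periodicity operator on cyclic cocycles\<close>

lemma b_comb:
  "hochschild_b n (\<lambda>xs. c * \<phi> xs + d * \<psi> xs) xs = c * hochschild_b n \<phi> xs + d * hochschild_b n \<psi> xs"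
  by (simp add: hochschild_b_def sum_distrib_left sum.distrib algebra_simps)

lemma tail_b_comb:
  "tail_b n (\<lambda>xs. c * \<phi> xs + d * \<psi> xs) xs = c * tail_b n \<phi> xs + d * tail_b n \<psi> xs"
  by (simp add: tail_b_def sum_distrib_left sum.distrib algebra_simps sum_subtractf sum_negf)

lemma cyc_comb: "cyc n (\<lambda>xs. c * \<phi> xs + d * \<psi> xs) xs = c * cyc n \<phi> xs + d * cyc n \<psi> xs"
  by (simp add: cyc_def algebra_simps)

lemma connes_S_comb:
  "connes_S n (\<lambda>xs. c * \<phi> xs + d * \<psi> xs) xs = c * connes_S n \<phi> xs + d * connes_S n \<psi> xs"
  by (simp add: connes_S_def sum_distrib_left sum.distrib algebra_simps)

lemma tail_b_sub: "tail_b n (\<lambda>xs. \<phi> xs - \<psi> xs) xs = tail_b n \<phi> xs - tail_b n \<psi> xs"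
  using tail_b_comb[of n 1 \<phi> "-1" \<psi> xs] by simp

lemma b_zero: "hochschild_b n (\<lambda>_. 0) = (\<lambda>_. 0)"
  by (auto simp: hochschild_b_def)

context complex_algebra
begin

lemma cyclic_b:
  assumes "\<theta> \<in> cochains s n" "tail_b n (\<lambda>xs. \<theta> xs - cyc n \<theta> xs) = (\<lambda>_. 0)"
  shows "hochschild_b n \<theta> \<in> cyclic_cochains s (Suc n)"
  unfolding cyclic_cochains_iff
proof
  show "cyc (Suc n) (hochschild_b n \<theta>) = hochschild_b n \<theta>"
  proof
    fix xs
    show "cyc (Suc n) (hochschild_b n \<theta>) xs = hochschild_b n \<theta> xs"
      using b_cyc[of n \<theta> xs] fun_cong[OF assms(2), of xs] by (simp add: tail_b_sub)
  qed
qed (simp add: cochain_b assms)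

lemma cyclic_cochains_comb:
  assumes "\<phi> \<in> cyclic_cochains s n" "\<psi> \<in> cyclic_cochains s n"
  shows "(\<lambda>xs. c * \<phi> xs + d * \<psi> xs) \<in> cyclic_cochains s n"
proof -
  have "cyc n (\<lambda>xs. c * \<phi> xs + d * \<psi> xs) = (\<lambda>xs. c * \<phi> xs + d * \<psi> xs)"
    using assms by (simp add: cyclic_cochains_iff fun_eq_iff cyc_comb)
  then show ?thesis
    using assms by (simp add: cyclic_cochains_iff cochains_comb)
qed

lemma cyclic_cochains_scale: "\<phi> \<in> cyclic_cochains s n \<Longrightarrow> (\<lambda>xs. c * \<phi> xs) \<in> cyclic_cochains s n"
  using cyclic_cochains_comb[of \<phi> n \<phi> c 0] by simp

lemma b_scale: "hochschild_b n (\<lambda>xs. c * \<phi> xs) xs = c * hochschild_b n \<phi> xs"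
  using b_comb[of n c \<phi> 0 \<phi> xs] by simp

text \<open>
  For a cyclic cocycle, \<open>(1 - T) \<theta>\<close> is a multiple of \<open>tail_b \<phi>\<close> with
  \<open>\<theta> = weighted_b \<phi>\<close>, and \<open>tail_b\<close> squares to zero; so \<open>b \<theta> = - S \<phi>\<close> is
  cyclic by \<open>cyclic_b\<close>.
\<close>

lemma connes_S_cocycle:
  assumes "\<phi> \<in> cyclic_cocycles s n"
  shows "connes_S n \<phi> \<in> cyclic_cocycles s (n + 2)"
proof -
  have \<phi>: "\<phi> \<in> cochains s n" "cyc n \<phi> = \<phi>" "hochschild_b n \<phi> = (\<lambda>_. 0)"
    using assms by (auto simp: cyclic_cocycles_def cyclic_cochains_iff)
  define \<theta> where "\<theta> = weighted_b n \<phi>"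
  have S: "connes_S n \<phi> = (\<lambda>xs. (-1) * hochschild_b (Suc n) \<theta> xs)"
    using connes_S_weighted_b[OF \<phi>(3)] by (auto simp: \<theta>_def)
  have "tail_b (Suc n) (\<lambda>xs. \<theta> xs - cyc (Suc n) \<theta> xs) xs = 0" for xs
    unfolding \<theta>_def weighted_b_cyc[OF \<phi>(2)]
    using tail_b_comb[of "Suc n" "of_nat n + 2" "tail_b n \<phi>" 0 "\<lambda>_. 0" xs]
    by (simp add: \<phi>(3) tail_b_tail_b)
  then have "hochschild_b (Suc n) \<theta> \<in> cyclic_cochains s (Suc (Suc n))"
    by (intro cyclic_b) (auto simp: \<theta>_def cochain_weighted_b \<phi>)
  then have "connes_S n \<phi> \<in> cyclic_cochains s (n + 2)"
    unfolding S using cyclic_cochains_scale[of "hochschild_b (Suc n) \<theta>" "Suc (Suc n)" "-1"] by simp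
  moreover have "hochschild_b (n + 2) (connes_S n \<phi>) = (\<lambda>_. 0)"
    unfolding S b_scale[abs_def] by (simp add: b_b)
  ultimately show ?thesis by (simp add: cyclic_cocycles_def)
qed

text \<open>
  For \<open>\<phi> = b \<eta>\<close> the cochain \<open>weighted_b \<phi>\<close>, whose coboundary is \<open>- S \<phi>\<close>, need not
  be cyclic. A multiple of \<open>b (weighted_b \<eta>)\<close> has the opposite defect under \<open>1 - T\<close> and no
  coboundary, so their sum is a cyclic cochain with the same coboundary.
\<close>

lemma connes_S_coboundary:
  assumes "\<eta> \<in> cyclic_cochains s m"
  shows "connes_S (Suc m) (hochschild_b m \<eta>) \<in> hochschild_b (m + 2) ` cyclic_cochains s (m + 2)"
proof -
  have \<eta>: "\<eta> \<in> cochains s m" "cyc m \<eta> = \<eta>"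
    using assms by (auto simp: cyclic_cochains_iff)
  define \<phi> where "\<phi> = hochschild_b m \<eta>"
  have b\<phi>: "hochschild_b (Suc m) \<phi> = (\<lambda>_. 0)" by (simp add: \<phi>_def b_b)
  have "\<phi> \<in> cyclic_cochains s (Suc m)"
    unfolding \<phi>_def using \<eta> by (intro cyclic_b) (auto simp: tail_b_def)
  then have \<phi>: "\<phi> \<in> cochains s (Suc m)" "cyc (Suc m) \<phi> = \<phi>"
    by (auto simp: cyclic_cochains_iff)
  define \<zeta> where "\<zeta> = weighted_b m \<eta>"
  \<comment> \<open>with \<open>n = m + 1\<close> the degree of \<open>\<phi>\<close>, the defects are in the ratio \<open>n + 2 : - n\<close>\<close>
  define c :: complex where "c = (of_nat m + 3) / (of_nat m + 1)"
  have c: "c * (of_nat m + 1) = of_nat m + 3"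
    using of_nat_neq_0[of m, where ?'a = complex] by (simp add: c_def add.commute)
  define \<kappa> where "\<kappa> = (\<lambda>xs. (-1) * weighted_b (Suc m) \<phi> xs + (- c) * hochschild_b (Suc m) \<zeta> xs)"
  have A: "hochschild_b (Suc m) \<zeta> xs - cyc (m + 2) (hochschild_b (Suc m) \<zeta>) xs =
      - (of_nat m + 1) * tail_b (Suc m) \<phi> xs" for xs
  proof -
    have "hochschild_b (Suc m) \<zeta> xs - cyc (m + 2) (hochschild_b (Suc m) \<zeta>) xs =
        tail_b (Suc m) (\<lambda>xs. \<zeta> xs - cyc (Suc m) \<zeta> xs) xs"
      using b_cyc[of "Suc m" \<zeta> xs] by (simp add: tail_b_sub)
    also have "(\<lambda>xs. \<zeta> xs - cyc (Suc m) \<zeta> xs) =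
        (\<lambda>xs. (of_nat m + 2) * tail_b m \<eta> xs + (- (of_nat m + 1)) * \<phi> xs)"
      using weighted_b_cyc[OF \<eta>(2)] by (auto simp: \<zeta>_def \<phi>_def algebra_simps)
    finally show ?thesis
      by (simp only: tail_b_comb tail_b_tail_b) simp
  qed
  have B: "weighted_b (Suc m) \<phi> xs - cyc (m + 2) (weighted_b (Suc m) \<phi>) xs =
      (of_nat m + 3) * tail_b (Suc m) \<phi> xs" for xs
    using weighted_b_cyc[OF \<phi>(2), of xs] by (simp add: b\<phi> add.commute)
  have "\<kappa> xs - cyc (m + 2) \<kappa> xs = (c * (of_nat m + 1) - (of_nat m + 3)) * tail_b (Suc m) \<phi> xs" for xs
  proof -
    have "\<kappa> xs - cyc (m + 2) \<kappa> xs =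
        - (weighted_b (Suc m) \<phi> xs - cyc (m + 2) (weighted_b (Suc m) \<phi>) xs) -
        c * (hochschild_b (Suc m) \<zeta> xs - cyc (m + 2) (hochschild_b (Suc m) \<zeta>) xs)"
      unfolding \<kappa>_def cyc_comb by (simp add: algebra_simps)
    then show ?thesis unfolding A B by (simp add: algebra_simps)
  qed
  then have "cyc (m + 2) \<kappa> = \<kappa>"
    by (auto simp: c)
  moreover have "\<kappa> \<in> cochains s (m + 2)"
    unfolding \<kappa>_def using cochain_weighted_b[OF \<phi>(1)] cochain_b[OF cochain_weighted_b[OF \<eta>(1)]]
    by (simp only: \<zeta>_def add_2_eq_Suc') (rule cochains_comb; simp)
  moreover have "hochschild_b (m + 2) \<kappa> = connes_S (Suc m) \<phi>"
  proof
    fix xs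
    show "hochschild_b (m + 2) \<kappa> xs = connes_S (Suc m) \<phi> xs"
      unfolding \<kappa>_def b_comb by (simp add: b_b connes_S_weighted_b[OF b\<phi>])
  qed
  ultimately show ?thesis
    unfolding \<phi>_def cyclic_cochains_iff[symmetric]
    by (intro image_eqI[of _ _ \<kappa>]) (auto simp: \<phi>_def cyclic_cochains_iff)
qed

lemma rotate_period:
  fixes \<omega> :: "'b list \<Rightarrow> complex"
  assumes "length xs = m + 1"
  shows "(-1) ^ (m * (m + 1)) * \<omega> (rotate (m + 1) xs) = \<omega> xs"
proof -
  have "rotate (m + 1) xs = xs" using assms by (intro rotate_id) simp
  moreover have "even (m * (m + 1))" by simp
  then have "(-1 :: complex) ^ (m * (m + 1)) = 1" by (rule neg_one_even_power)
  ultimately show ?thesis by simp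
qed

text \<open>
  The finite cyclic group generated by \<open>T\<close> acts on cochains of degree \<open>m\<close>: averaging splits
  off the invariants, and the complement is the image of \<open>1 - T\<close>.
\<close>

lemma cyclic_decomposition:
  assumes \<omega>: "\<omega> \<in> cochains s m"
  obtains \<nu> \<delta> where "\<nu> \<in> cyclic_cochains s m" "\<delta> \<in> cochains s m"
    "\<And>xs. (of_nat m + 1) * \<omega> xs = \<nu> xs + (\<delta> xs - cyc m \<delta> xs)"
proof
  define t where "t = (\<lambda>k xs. (-1) ^ (m * k) * \<omega> (rotate k xs))"
  define \<nu> where "\<nu> = (\<lambda>xs. \<Sum>k<Suc m. t k xs)"
  define \<delta> where "\<delta> = (\<lambda>xs. \<Sum>k<Suc m. \<Sum>l<k. t l xs)"
  have t: "t k \<in> cochains s m" for k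
    unfolding t_def by (intro cochains_scale cochain_rotate \<omega>)
  then show \<delta>: "\<delta> \<in> cochains s m"
    unfolding \<delta>_def by (intro cochains_sum)
  have \<nu>: "\<nu> \<in> cochains s m"
    unfolding \<nu>_def using t by (intro cochains_sum)
  have tS: "(-1) ^ m * t k (rotate1 xs) = t (Suc k) xs" for k xs
    by (simp add: t_def power_add rotate1_rotate_swap mult.assoc)
  have per: "t (Suc m) xs = t 0 xs" if "length xs = m + 1" for xs
    using rotate_period[OF that, of \<omega>] by (simp add: t_def)
  have "cyc m \<nu> xs = \<nu> xs" for xs
  proof (cases "length xs = m + 1")
    case True
    have "cyc m \<nu> xs = (\<Sum>k<Suc m. t (Suc k) xs)"
      by (simp add: cyc_def \<nu>_def sum_distrib_left tS del: sum.lessThan_Suc)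
    also have "\<dots> = \<nu> xs"
      using per[OF True] sum.lessThan_Suc_shift[of "\<lambda>k. t k xs" "Suc m"] by (simp add: \<nu>_def)
    finally show ?thesis .
  next
    case False
    then show ?thesis using \<nu> cochain_cyc[OF \<nu>] by (simp add: cochain_eq_0)
  qed
  then show "\<nu> \<in> cyclic_cochains s m" using \<nu> by (auto simp: cyclic_cochains_iff)
  fix xs
  have "cyc m \<delta> xs = (\<Sum>k<Suc m. \<Sum>l<k. t (Suc l) xs)"
    by (simp add: cyc_def \<delta>_def sum_distrib_left tS del: sum.lessThan_Suc)
  then have "\<delta> xs - cyc m \<delta> xs = (\<Sum>k<Suc m. \<Sum>l<k. t l xs - t (Suc l) xs)"
    by (simp add: \<delta>_def sum_subtractf del: sum.lessThan_Suc)
  also have "\<dots> = (\<Sum>k<Suc m. t 0 xs - t k xs)"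
  proof (rule sum.cong[OF refl])
    fix k
    show "(\<Sum>l<k. t l xs - t (Suc l) xs) = t 0 xs - t k xs"
      by (induction k) auto
  qed
  also have "t 0 xs = \<omega> xs"
    by (simp add: t_def)
  finally show "(of_nat m + 1) * \<omega> xs = \<nu> xs + (\<delta> xs - cyc m \<delta> xs)"
    by (simp add: \<nu>_def sum_subtractf algebra_simps del: sum.lessThan_Suc)
qed

text \<open>
  Summing the invariant cochain \<open>\<phi> = \<delta> - T \<delta>\<close> over all rotations gives
  \<open>(m + 1) \<phi>\<close> on the one side and a telescoping sum equal to zero on the other.
\<close>

lemma cyclic_diff_eq_0:
  assumes \<phi>: "\<phi> \<in> cyclic_cochains s m" and \<delta>: "\<And>xs. \<phi> xs = \<delta> xs - cyc m \<delta> xs"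
  shows "\<phi> xs = 0"
proof (cases "length xs = m + 1")
  case True
  define t where "t k = (-1) ^ (m * k) * \<delta> (rotate k xs)" for k
  have "\<phi> xs = t k - t (Suc k)" for k
  proof -
    have "\<phi> xs = (-1) ^ (m * k) * \<phi> (rotate k xs)"
    proof (induction k)
      case (Suc k)
      have "\<phi> (rotate k xs) = (-1) ^ m * \<phi> (rotate1 (rotate k xs))"
        using \<phi> by (simp add: cyclic_cochains_iff cyc_def fun_eq_iff)
      then show ?case using Suc by (simp add: power_add)
    qed simp
    then show ?thesis
      using \<delta>[of "rotate k xs"] by (simp add: t_def cyc_def power_add algebra_simps)
  qed
  then have "(\<Sum>k<m + 1. \<phi> xs) = t 0 - t (m + 1)"
    using sum_lessThan_telescope'[of t "m + 1"] by (simp del: sum_constant)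
  also have "\<dots> = 0" using rotate_period[OF True, of \<delta>] by (simp add: t_def)
  finally show ?thesis using of_nat_neq_0[of m, where ?'a = complex] by simp
qed (use \<phi> cochain_eq_0[of \<phi> m xs] in \<open>simp add: cyclic_cochains_iff\<close>)

text \<open>
  Exactness of Connes' sequence at the cyclic cohomology group: a cyclic cocycle that is a Hochschild
  coboundary \<open>b \<eta>\<close> is in the image of \<open>S\<close> up to the coboundary of a cyclic cochain. Since
  \<open>tail_b\<close> kills \<open>\<eta> - T \<eta>\<close>, it equals \<open>tail_b \<omega>\<close> for some \<open>\<omega>\<close>, and the
  cyclic average \<open>\<nu>\<close> of \<open>\<omega>\<close> is the required preimage up to a factor. This is the operator
  \<open>B\<close> in disguise.
\<close>

lemma connes_S_onto:
  assumes \<phi>: "\<phi> \<in> cyclic_cochains s (m + 2)"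
    and \<eta>: "\<eta> \<in> cochains s (Suc m)" "hochschild_b (Suc m) \<eta> = \<phi>"
  obtains \<nu> \<kappa> where "\<nu> \<in> cyclic_cocycles s m" "\<kappa> \<in> cyclic_cochains s (Suc m)"
    "\<And>xs. \<phi> xs = connes_S m \<nu> xs + hochschild_b (Suc m) \<kappa> xs"
proof -
  define \<mu> where "\<mu> = (\<lambda>xs. \<eta> xs - cyc (Suc m) \<eta> xs)"
  have \<mu>: "\<mu> \<in> cochains s (Suc m)"
    unfolding \<mu>_def by (intro cochains_sub \<eta> cochain_cyc)
  have "tail_b (Suc m) \<mu> xs = 0" for xs
    using b_cyc[of "Suc m" \<eta> xs] \<phi> by (simp add: \<mu>_def tail_b_sub \<eta>(2) cyclic_cochains_iff)
  then have b\<mu>: "tail_b (Suc m) \<mu> = (\<lambda>_. 0)" by auto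
  define \<omega> where "\<omega> = (\<lambda>xs. (-1) * (if length xs = m + 1 then \<mu> (insert_one xs) else 0))"
  have \<omega>: "\<omega> \<in> cochains s m"
    unfolding \<omega>_def by (intro cochains_scale cochain_insert_one \<mu>)
  have b\<omega>: "tail_b m \<omega> xs = \<mu> xs" for xs
  proof (cases "length xs = m + 2")
    case True
    have "tail_b m \<omega> xs = - tail_b m (\<lambda>ys. \<mu> (insert_one ys)) xs"
      using True by (simp add: tail_b_def \<omega>_def length_face sum_negf)
    then show ?thesis using tail_b_insert_one[OF b\<mu> True] by simp
  qed (use \<mu> in \<open>simp add: tail_b_def cochain_eq_0\<close>)
  obtain \<nu> \<delta> where \<nu>: "\<nu> \<in> cyclic_cochains s m" and \<delta>: "\<delta> \<in> cochains s m"
    and dec: "\<And>xs. (of_nat m + 1) * \<omega> xs = \<nu> xs + (\<delta> xs - cyc m \<delta> xs)"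
    using cyclic_decomposition[OF \<omega>] by metis
  \<comment> \<open>the correction by \<open>b \<delta>\<close> makes \<open>tail_b \<nu> = (1 - T) \<rho>\<close>, and \<open>b \<rho>\<close> is still a multiple of \<open>\<phi>\<close>\<close>
  define \<rho> where "\<rho> = (\<lambda>xs. (of_nat m + 1) * \<eta> xs + (-1) * hochschild_b m \<delta> xs)"
  have \<rho>: "\<rho> \<in> cochains s (Suc m)"
    unfolding \<rho>_def by (intro cochains_comb \<eta> cochain_b \<delta>)
  have b\<nu>: "tail_b m \<nu> xs = \<rho> xs - cyc (Suc m) \<rho> xs" for xs
  proof -
    have "\<nu> = (\<lambda>xs. (of_nat m + 1) * \<omega> xs + (-1) * (\<delta> xs - cyc m \<delta> xs))"
      by (simp add: dec)
    then have "tail_b m \<nu> xs = (of_nat m + 1) * \<mu> xs + (-1) * (tail_b m \<delta> xs - tail_b m (cyc m \<delta>) xs)"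
      by (simp only: tail_b_comb tail_b_sub b\<omega>)
    then show ?thesis
      unfolding \<rho>_def cyc_comb b_cyc[symmetric] by (simp add: \<mu>_def algebra_simps)
  qed
  have cyc\<nu>: "cyc m \<nu> = \<nu>" "\<nu> \<in> cochains s m" using \<nu> by (auto simp: cyclic_cochains_iff)
  define \<theta> where "\<theta> = weighted_b m \<nu>"
  have \<theta>: "\<theta> \<in> cochains s (Suc m)" unfolding \<theta>_def by (intro cochain_weighted_b cyc\<nu>)
  \<comment> \<open>a cyclic cochain whose coboundary is \<open>- S \<nu> - (m + 1) (m + 2) \<phi>\<close>, once \<open>\<nu>\<close> is a cocycle\<close>
  define \<kappa>0 where "\<kappa>0 = (\<lambda>xs. 1 * \<theta> xs + (- (of_nat m + 2)) * \<rho> xs)"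
  have \<kappa>0: "\<kappa>0 \<in> cochains s (Suc m)"
    unfolding \<kappa>0_def by (intro cochains_comb \<theta> \<rho>)
  have cyc\<kappa>: "\<kappa>0 xs - cyc (Suc m) \<kappa>0 xs = - (of_nat m + 1) * hochschild_b m \<nu> xs" for xs
    using weighted_b_cyc[OF cyc\<nu>(1), of xs] b\<nu>[of xs]
    unfolding \<kappa>0_def cyc_comb \<theta>_def by (simp add: algebra_simps)
  have m1: "of_nat m + 1 \<noteq> (0 :: complex)" "of_nat m + 2 \<noteq> (0 :: complex)"
    using of_nat_neq_0[of m, where ?'a = complex] of_nat_neq_0[of "Suc m", where ?'a = complex]
    by (auto simp: add.commute)
  \<comment> \<open>\<open>b \<nu>\<close> is both cyclic and of the form \<open>(1 - T) \<kappa>0\<close> up to a factor, hence zero\<close>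
  have "hochschild_b m \<nu> \<in> cyclic_cochains s (Suc m)"
    using cyc\<nu> by (intro cyclic_b) (auto simp: tail_b_def)
  then have "(\<lambda>xs. - (of_nat m + 1) * hochschild_b m \<nu> xs) \<in> cyclic_cochains s (Suc m)"
    by (rule cyclic_cochains_scale)
  then have "- (of_nat m + 1) * hochschild_b m \<nu> xs = 0" for xs
    by (rule cyclic_diff_eq_0[where \<delta> = \<kappa>0]) (simp only: cyc\<kappa>)
  then have "hochschild_b m \<nu> xs = 0" for xs
    using m1(1) by (metis mult_eq_0_iff neg_equal_0_iff_equal)
  then have b0: "hochschild_b m \<nu> = (\<lambda>_. 0)" by (rule ext)
  \<comment> \<open>for a cocycle \<open>\<nu>\<close> the defect of \<open>\<kappa>0\<close> is zero\<close>
  have \<kappa>c: "\<kappa>0 \<in> cyclic_cochains s (Suc m)"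
    using \<kappa>0 cyc\<kappa> by (auto simp: cyclic_cochains_iff b0)
  define c :: complex where "c = - 1 / ((of_nat m + 1) * (of_nat m + 2))"
  have b\<kappa>: "hochschild_b (Suc m) \<kappa>0 xs =
      - connes_S m \<nu> xs - (of_nat m + 2) * (of_nat m + 1) * \<phi> xs" for xs
    unfolding \<kappa>0_def b_comb \<rho>_def \<theta>_def
    by (simp add: b_b \<eta>(2) connes_S_weighted_b[OF b0] algebra_simps)
  have cp: "c * connes_S m \<nu> xs + c * (- connes_S m \<nu> xs - (of_nat m + 2) * (of_nat m + 1) * \<phi> xs) = \<phi> xs"
    for xs
  proof -
    have "c * ((of_nat m + 1) * (of_nat m + 2)) = - 1" using m1 by (simp add: c_def)
    moreover have "c * connes_S m \<nu> xs + c * (- connes_S m \<nu> xs - (of_nat m + 2) * (of_nat m + 1) * \<phi> xs) =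
        - (c * ((of_nat m + 1) * (of_nat m + 2))) * \<phi> xs"
      by (simp add: algebra_simps)
    ultimately show ?thesis by simp
  qed
  show thesis
  proof (rule that[of "\<lambda>xs. c * \<nu> xs" "\<lambda>xs. c * \<kappa>0 xs"])
    show "(\<lambda>xs. c * \<nu> xs) \<in> cyclic_cocycles s m"
      using cyclic_cochains_scale[OF \<nu>] b0 by (simp add: cyclic_cocycles_def b_scale[abs_def])
    show "(\<lambda>xs. c * \<kappa>0 xs) \<in> cyclic_cochains s (Suc m)"
      by (rule cyclic_cochains_scale[OF \<kappa>c])
    fix xs
    have "connes_S m (\<lambda>xs. c * \<nu> xs) xs = c * connes_S m \<nu> xs"
      using connes_S_comb[of m c \<nu> 0 \<nu> xs] by simp
    then show "\<phi> xs = connes_S m (\<lambda>xs. c * \<nu> xs) xs + hochschild_b (Suc m) (\<lambda>xs. c * \<kappa>0 xs) xs"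
      unfolding b_scale b\<kappa> using cp[of xs] by simp
  qed
qed

end


section \<open>Functionals on group algebras\<close>

lemma grp_scale_single: "grp_scale c (Poly_Mapping.single g v) = Poly_Mapping.single g (c * v)"
  by (rule poly_mapping_eqI) (simp add: lookup_grp_scale lookup_single when_def)

lemma grp_scale_add: "grp_scale c (x + y) = grp_scale c x + grp_scale c y"
  by (rule poly_mapping_eqI) (simp add: lookup_grp_scale lookup_add algebra_simps)

text \<open>
  The induction step adds an arbitrary multiple of a group element, so that no side condition on
  supports has to be checked.
\<close>

lemma group_algebra_induct [case_names zero sum]:
  fixes a :: "'g \<Rightarrow>\<^sub>0 complex"
  assumes "P 0" "\<And>a g v. P a \<Longrightarrow> P (a + Poly_Mapping.single g v)"
  shows "P a"
proof (induction a rule: Poly_Mapping.update_induct)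
  case const
  show ?case by fact
next
  case (update a g v)
  have "Poly_Mapping.update g v a = a + Poly_Mapping.single g v"
    using update by (intro poly_mapping_eqI)
      (auto simp: lookup_update lookup_add lookup_single when_def in_keys_iff)
  then show ?case using update assms(2) by simp
qed

lemma grp_scale_zero: "grp_scale c 0 = 0"
  by (rule poly_mapping_eqI) (simp add: lookup_grp_scale)

lemma grp_scale_mult_single:
  "grp_scale c x * Poly_Mapping.single h v = grp_scale c (x * Poly_Mapping.single h v)"
  "Poly_Mapping.single h v * grp_scale c x = grp_scale c (Poly_Mapping.single h v * x)"
  for x :: "'g::monoid_add \<Rightarrow>\<^sub>0 complex"
  by (induction x rule: group_algebra_induct;
      simp add: grp_scale_single mult_single grp_scale_zero grp_scale_add distrib_left distrib_right mult_ac)+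

interpretation grp: complex_algebra "grp_scale :: complex \<Rightarrow> ('g::monoid_add \<Rightarrow>\<^sub>0 complex) \<Rightarrow> _"
proof (intro complex_algebra.intro complex_algebra_axioms.intro vector_space_grp_scale)
  fix c and x y :: "'g \<Rightarrow>\<^sub>0 complex"
  show "grp_scale c x * y = grp_scale c (x * y)"
    by (induction y rule: group_algebra_induct)
      (simp_all add: grp_scale_mult_single grp_scale_zero grp_scale_add distrib_left)
  show "x * grp_scale c y = grp_scale c (x * y)"
    by (induction x rule: group_algebra_induct)
      (simp_all add: grp_scale_mult_single grp_scale_zero grp_scale_add distrib_right)
qed

lemma grp_elem_mult: "grp_elem g * grp_elem h = grp_elem (g + h)"
  for g h :: "'g::monoid_add" by (simp add: mult_single)

definition lift :: "('g \<Rightarrow> complex) \<Rightarrow> ('g \<Rightarrow>\<^sub>0 complex) \<Rightarrow> complex" where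
  "lift f a = (\<Sum>g\<in>Poly_Mapping.keys a. Poly_Mapping.lookup a g * f g)"

lemma lift_superset:
  "finite F \<Longrightarrow> Poly_Mapping.keys a \<subseteq> F \<Longrightarrow> lift f a = (\<Sum>g\<in>F. Poly_Mapping.lookup a g * f g)"
  unfolding lift_def by (rule sum.mono_neutral_left) (auto simp: in_keys_iff)

lemma lift_add: "lift f (a + b) = lift f a + lift f b"
proof -
  let ?F = "Poly_Mapping.keys a \<union> Poly_Mapping.keys b"
  have "lift f (a + b) = (\<Sum>g\<in>?F. Poly_Mapping.lookup (a + b) g * f g)"
    using Poly_Mapping.keys_add[of a b] by (intro lift_superset) simp_all
  moreover have "lift f a = (\<Sum>g\<in>?F. Poly_Mapping.lookup a g * f g)"
    by (rule lift_superset) auto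
  moreover have "lift f b = (\<Sum>g\<in>?F. Poly_Mapping.lookup b g * f g)"
    by (rule lift_superset) auto
  ultimately show ?thesis by (simp add: lookup_add distrib_right sum.distrib)
qed

lemma lift_scale: "lift f (grp_scale c a) = c * lift f a"
proof -
  have "lift f (grp_scale c a) =
      (\<Sum>g\<in>Poly_Mapping.keys a. Poly_Mapping.lookup (grp_scale c a) g * f g)"
    by (rule lift_superset) (auto simp: in_keys_iff lookup_grp_scale)
  then show ?thesis by (simp add: lookup_grp_scale lift_def sum_distrib_left mult_ac)
qed

lemma lift_grp_elem: "lift f (grp_elem g) = f g"
  by (simp add: lift_def)

lemma lift_comb: "lift (\<lambda>g. c * f g + d * f' g) a = c * lift f a + d * lift f' a"
  by (simp add: lift_def sum_distrib_left sum.distrib algebra_simps)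

lemma lin_functional_ext:
  fixes f f' :: "('g::monoid_add \<Rightarrow>\<^sub>0 complex) \<Rightarrow> complex"
  assumes "lin_functional grp_scale f" "lin_functional grp_scale f'"
    and "\<And>g. f (grp_elem g) = f' (grp_elem g)"
  shows "f a = f' a"
proof (induction a rule: group_algebra_induct)
  case zero
  show ?case using assms(1,2) unfolding grp.lin_functional_iff by (metis add_cancel_left_left)
next
  case (sum a g v)
  have "Poly_Mapping.single g v = grp_scale v (grp_elem g)" by (simp add: grp_scale_single)
  then show ?case using assms sum by (simp add: grp.lin_functional_iff)
qed

text \<open>
  Entries are replaced by group elements one at a time: the positions from \<open>k\<close> on are assumed to be
  group elements already.
\<close>

lemma cochain_ext:
  fixes \<phi> \<phi>' :: "('g::monoid_add \<Rightarrow>\<^sub>0 complex) list \<Rightarrow> complex"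
  assumes \<phi>: "\<phi> \<in> cochains grp_scale n" "\<phi>' \<in> cochains grp_scale n"
    and eq: "\<And>gs. length gs = n + 1 \<Longrightarrow> \<phi> (map grp_elem gs) = \<phi>' (map grp_elem gs)"
  shows "\<phi> = \<phi>'"
proof
  fix xs :: "('g \<Rightarrow>\<^sub>0 complex) list"
  have "\<phi> xs = \<phi>' xs"
    if "length xs = n + 1" "k \<le> n + 1" "\<forall>i<n + 1. k \<le> i \<longrightarrow> xs ! i \<in> range grp_elem" for xs k
    using that
  proof (induction k arbitrary: xs)
    case 0
    then have "\<exists>gs. xs = map grp_elem gs"
      by (intro ex_map_conv[THEN iffD2]) (force simp: in_set_conv_nth)
    then show ?case using eq 0 by auto
  next
    case (Suc k)
    have "\<phi> (xs[k := a]) = \<phi>' (xs[k := a])" for a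
    proof (rule lin_functional_ext)
      show "lin_functional grp_scale (\<lambda>a. \<phi> (xs[k := a]))" "lin_functional grp_scale (\<lambda>a. \<phi>' (xs[k := a]))"
        using \<phi> Suc.prems by (auto simp: cochains_def)
      fix g
      show "\<phi> (xs[k := grp_elem g]) = \<phi>' (xs[k := grp_elem g])"
        using Suc.prems by (intro Suc.IH) (auto simp: nth_list_update)
    qed
    from this[of "xs ! k"] show ?case by simp
  qed
  from this[of xs "n + 1"] show "\<phi> xs = \<phi>' xs"
    using grp.cochain_eq_0[OF \<phi>(1)] grp.cochain_eq_0[OF \<phi>(2)] by (cases "length xs = n + 1") auto
qed

section \<open>Path integrals along the Cayley graph of the dihedral group\<close>

text \<open>
  The Cayley graph of the infinite dihedral group with respect to the reflections \<open>e\<close> and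
  \<open>S e\<close> is a line. On a tree, every antisymmetric function \<open>q\<close> on oriented edges is the
  gradient of a function \<open>p\<close> on vertices, which is unique when normalised at the unit; \<open>p x\<close> is
  the sum of \<open>q\<close> along the path from the unit to \<open>x\<close>.
\<close>

definition potential :: "(dihedral \<Rightarrow> dihedral \<Rightarrow> complex) \<Rightarrow> (dihedral \<Rightarrow> complex) \<Rightarrow> bool" where
  "potential q p \<longleftrightarrow> p 0 = 0 \<and>
     (\<forall>x. p (x + dih_e) - p x = q x (x + dih_e) \<and>
       p (x + (dih_S + dih_e)) - p x = q x (x + (dih_S + dih_e)))"

abbreviation antisym_edges :: "(dihedral \<Rightarrow> dihedral \<Rightarrow> complex) \<Rightarrow> bool" where
  "antisym_edges q \<equiv> (\<forall>x y. q x y = - q y x)"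

lemma dih_add_gens:
  "Dih m False + dih_e = Dih m True" "Dih m True + dih_e = Dih m False"
  "Dih m False + (dih_S + dih_e) = Dih (m + 1) True" "Dih m True + (dih_S + dih_e) = Dih (m - 1) False"
  by (simp_all add: plus_dihedral_def dih_S_def dih_e_def)

lemma int_antidifference: "\<exists>J :: int \<Rightarrow> complex. J 0 = 0 \<and> (\<forall>k. J (k + 1) = J k + w k)"
proof -
  define J where "J m = (if 0 \<le> m then \<Sum>k<nat m. w (int k) else - (\<Sum>k<nat (- m). w (- int k - 1)))" for m
  have "J (k + 1) = J k + w k" for k
  proof (cases "0 \<le> k")
    case True
    then have "nat (k + 1) = Suc (nat k)" by simp
    then show ?thesis using True by (simp add: J_def)
  next
    case False
    then have "nat (- k) = Suc (nat (- (k + 1)))" by simp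
    then have "J k = - (\<Sum>j<nat (- (k + 1)). w (- int j - 1)) - w k"
      using False by (simp add: J_def)
    moreover have "J (k + 1) = - (\<Sum>j<nat (- (k + 1)). w (- int j - 1))"
      using False by (auto simp: J_def)
    ultimately show ?thesis by simp
  qed
  moreover have "J 0 = 0" by (simp add: J_def)
  ultimately show ?thesis by blast
qed

text \<open>
  The edges met on the way from \<open>S\<^sup>k\<close> to \<open>S\<^sup>k\<^sup>+\<^sup>1\<close> are those to and from
  \<open>S\<^sup>k\<^sup>+\<^sup>1 e\<close>, so that the potential at the rotations is an antidifference of the sum \<open>w\<close> of these two edge
  values.
\<close>

lemma potential_exists:
  assumes "antisym_edges q"
  shows "\<exists>p. potential q p"
proof -
  define w where "w k = q (Dih k False) (Dih (k + 1) True) + q (Dih (k + 1) True) (Dih (k + 1) False)" for k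
  obtain J where J: "J 0 = 0" "\<And>k. J (k + 1) = J k + w k"
    using int_antidifference by blast
  define p where "p x = J (rot x) + (if flip x then q (Dih (rot x) False) x else 0)" for x
  have swap: "q (Dih m True) (Dih n False) = - q (Dih n False) (Dih m True)" for m n
    using assms by blast
  have 1: "p (x + dih_e) - p x = q x (x + dih_e)" for x
  proof (cases x)
    case (Dih m b)
    then show ?thesis by (cases b) (simp_all add: p_def dih_add_gens swap)
  qed
  have 2: "p (x + (dih_S + dih_e)) - p x = q x (x + (dih_S + dih_e))" for x
  proof (cases x)
    case (Dih m b)
    then show ?thesis
      using J(2)[of m] J(2)[of "m - 1"] by (cases b) (simp_all add: p_def dih_add_gens w_def swap)
  qed
  show ?thesis
    by (rule exI[of _ p]) (simp add: potential_def 1 2, simp add: p_def J zero_dihedral_def)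
qed

lemma potential_unique:
  assumes "potential q p" "potential q p'"
  shows "p = p'"
proof
  define d where "d x = p x - p' x" for x
  have e: "d (x + dih_e) = d x" for x
  proof -
    have "p (x + dih_e) - p x = p' (x + dih_e) - p' x"
      using assms by (simp add: potential_def)
    then show ?thesis by (simp add: d_def diff_eq_eq add.commute diff_add_eq)
  qed
  have f: "d (x + (dih_S + dih_e)) = d x" for x
  proof -
    have "p (x + (dih_S + dih_e)) - p x = p' (x + (dih_S + dih_e)) - p' x"
      using assms by (simp add: potential_def)
    then show ?thesis by (simp add: d_def diff_eq_eq add.commute diff_add_eq)
  qed
  have step: "d (Dih (m + 1) False) = d (Dih m False)" for m
    using f[of "Dih m False"] e[of "Dih (m + 1) True"] by (simp add: dih_add_gens)
  have "d (Dih m False) = 0" for m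
  proof (induction m rule: int_induct[of _ 0])
    case base
    then show ?case using assms by (simp add: d_def potential_def zero_dihedral_def)
  next
    case (step1 i)
    then show ?case using step by simp
  next
    case (step2 i)
    then show ?case using step[of "i - 1"] by simp
  qed
  moreover have "d (Dih m True) = d (Dih m False)" for m
    using e[of "Dih m False"] by (simp add: dih_add_gens)
  ultimately have "d x = 0" for x
    by (cases x) (metis (full_types))
  then show "p x = p' x" for x by (simp add: d_def)
qed

definition path_integral :: "(dihedral \<Rightarrow> dihedral \<Rightarrow> complex) \<Rightarrow> dihedral \<Rightarrow> complex" where
  "path_integral q = (SOME p. potential q p)"

lemma potential_path_integral: "antisym_edges q \<Longrightarrow> potential q (path_integral q)"
  unfolding path_integral_def by (rule someI_ex[OF potential_exists])

lemma path_integral_eqI: "potential q p \<Longrightarrow> path_integral q = p"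
  unfolding path_integral_def by (rule some_equality) (auto intro: potential_unique)

text \<open>
  The path from \<open>1\<close> to \<open>g h\<close> consists of the path from \<open>1\<close> to \<open>g\<close> and the
  translate by \<open>g\<close> of the path from \<open>1\<close> to \<open>h\<close>; backtracking cancels.
\<close>

lemma path_integral_add:
  assumes "antisym_edges q"
  shows "path_integral q (g + h) = path_integral q g + path_integral (\<lambda>x y. q (g + x) (g + y)) h"
proof -
  have "potential (\<lambda>x y. q (g + x) (g + y)) (\<lambda>x. path_integral q (g + x) - path_integral q g)"
    using potential_path_integral[OF assms] by (simp add: potential_def add.assoc[symmetric])
  from path_integral_eqI[OF this] show ?thesis by simp
qed

lemma path_integral_gradient: "path_integral (\<lambda>x y. r y - r x) g = r g - r 0"
proof -
  have "potential (\<lambda>x y. r y - r x) (\<lambda>x. r x - r 0)" by (simp add: potential_def)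
  from path_integral_eqI[OF this] show ?thesis by simp
qed

lemma path_integral_comb:
  assumes "antisym_edges q" "antisym_edges q'"
  shows "path_integral (\<lambda>x y. c * q x y + d * q' x y) g = c * path_integral q g + d * path_integral q' g"
proof -
  have "potential (\<lambda>x y. c * q x y + d * q' x y) (\<lambda>x. c * path_integral q x + d * path_integral q' x)"
    using potential_path_integral[OF assms(1)] potential_path_integral[OF assms(2)]
    unfolding potential_def by (simp add: algebra_simps)
  from path_integral_eqI[OF this] show ?thesis by simp
qed

section \<open>Vanishing of the Hochschild cohomology in degrees at least two\<close>

type_synonym tri = "dihedral \<Rightarrow> dihedral \<Rightarrow> dihedral \<Rightarrow> complex"

text \<open>
  A trilinear functional \<open>\<tau>\<close> on the group algebra \<open>A\<close> is a functional on the bimodule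
  \<open>A \<otimes> A \<otimes> A\<close>. There is a derivation \<open>D : A \<rightarrow> A \<otimes> A \<otimes> A\<close> whose value \<open>D g\<close> is the sum
  of the terms \<open>(x \<otimes> x\<^sup>-\<^sup>1 y \<otimes> y\<^sup>-\<^sup>1 g - y \<otimes> y\<^sup>-\<^sup>1 x \<otimes> x\<^sup>-\<^sup>1 g) / 2\<close> over the edges
  \<open>(x, y)\<close> on the path from \<open>1\<close> to \<open>g\<close>; \<open>edge_value\<close> is \<open>\<tau>\<close> at one such term, and
  \<open>derivation \<tau> g\<close> below is \<open>\<tau> (D g)\<close>. The boundary
  \<open>x \<otimes> y \<otimes> z \<mapsto> x y \<otimes> z - x \<otimes> y z\<close> sends the term of the edge \<open>(x, y)\<close> to
  \<open>y \<otimes> y\<^sup>-\<^sup>1 g - x \<otimes> x\<^sup>-\<^sup>1 g\<close>, so the boundary of \<open>D g\<close> telescopes to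
  \<open>g \<otimes> 1 - 1 \<otimes> g\<close>. Thus \<open>D\<close> lifts the universal derivation, and the bimodule of noncommutative
  differentials is projective; this is why the cohomology vanishes from degree two on.
\<close>

definition edge_value :: "tri \<Rightarrow> dihedral \<Rightarrow> dihedral \<Rightarrow> dihedral \<Rightarrow> complex" where
  "edge_value \<tau> g x y = (\<tau> x (- x + y) (- y + g) - \<tau> y (- y + x) (- x + g)) / 2"

definition derivation :: "tri \<Rightarrow> dihedral \<Rightarrow> complex" where
  "derivation \<tau> g = path_integral (edge_value \<tau> g) g"

text \<open>
  For normalised cochains, which vanish when an entry other than the first is the unit,
  \<open>- derivation\<close> would be enough to build a homotopy. The term \<open>\<tau> g 0 0\<close>, where \<open>0\<close> is the unit of the group, corrects the homotopy
  for all others.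
\<close>

definition contraction :: "tri \<Rightarrow> dihedral \<Rightarrow> complex" where
  "contraction \<tau> g = \<tau> g 0 0 - derivation \<tau> g"

lemma antisym_edge_value: "antisym_edges (edge_value \<tau> g)"
  by (simp add: edge_value_def field_simps)

lemma derivation_add:
  "derivation \<tau> (g + h) = derivation (\<lambda>x y z. \<tau> x y (z + h)) g + derivation (\<lambda>x. \<tau> (g + x)) h"
proof -
  have "edge_value \<tau> (g + h) = edge_value (\<lambda>x y z. \<tau> x y (z + h)) g"
    by (intro ext) (simp add: edge_value_def add.assoc)
  moreover have "(\<lambda>x y. edge_value \<tau> (g + h) (g + x) (g + y)) = edge_value (\<lambda>x. \<tau> (g + x)) h"
  proof -
    have c: "- (g + x) + (g + y) = - x + y" for x y :: dihedral
      by (simp only: minus_add add.assoc minus_add_cancel)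
    show ?thesis by (intro ext) (simp add: edge_value_def c)
  qed
  ultimately show ?thesis
    unfolding derivation_def path_integral_add[OF antisym_edge_value] by simp
qed

lemma contraction_add:
  "contraction \<tau> (g + h) =
    contraction (\<lambda>x y z. \<tau> x y (z + h)) g + contraction (\<lambda>x. \<tau> (g + x)) h - \<tau> g 0 h"
  by (simp add: contraction_def derivation_add)

lemma contraction_boundary: "contraction (\<lambda>x y z. \<sigma> (x + y) z - \<sigma> x (y + z)) g = \<sigma> 0 g - \<sigma> g 0"
proof -
  have "edge_value (\<lambda>x y z. \<sigma> (x + y) z - \<sigma> x (y + z)) g = (\<lambda>x y. \<sigma> y (- y + g) - \<sigma> x (- x + g))"
    by (intro ext) (simp add: edge_value_def add.assoc)
  then show ?thesis
    by (simp add: contraction_def derivation_def path_integral_gradient[where r = "\<lambda>x. \<sigma> x (- x + g)"])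
qed

lemma contraction_comb:
  "contraction (\<lambda>x y z. c * \<tau> x y z + d * \<tau>' x y z) g = c * contraction \<tau> g + d * contraction \<tau>' g"
proof -
  have "edge_value (\<lambda>x y z. c * \<tau> x y z + d * \<tau>' x y z) g =
      (\<lambda>x y. c * edge_value \<tau> g x y + d * edge_value \<tau>' g x y)"
    by (intro ext) (simp add: edge_value_def field_simps)
  then show ?thesis
    by (simp add: contraction_def derivation_def path_integral_comb[OF antisym_edge_value antisym_edge_value] algebra_simps)
qed

lemma contraction_sum:
  assumes "finite I"
  shows "contraction (\<lambda>x y z. \<Sum>i\<in>I. c i * \<tau> i x y z) g = (\<Sum>i\<in>I. c i * contraction (\<tau> i) g)"
  using assms
proof (induction I)
  case empty
  show ?case using contraction_comb[of 0 "\<lambda>_ _ _. 0" 0 "\<lambda>_ _ _. 0" g] by simp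
next
  case (insert i I)
  then show ?case
    using contraction_comb[of "c i" "\<tau> i" 1 "\<lambda>x y z. \<Sum>i\<in>I. c i * \<tau> i x y z" g] by simp
qed

text \<open>
  Dual to the map \<open>a\<^sub>0 \<otimes> a\<^sub>1 \<otimes> a\<^sub>2 \<otimes> \<dots> \<mapsto>
  a\<^sub>0 (a\<^sub>1 \<otimes> 1 \<otimes> 1 - D a\<^sub>1) \<otimes> a\<^sub>2 \<otimes> \<dots>\<close> on the bar resolution, which is a
  contracting homotopy from degree two on.
\<close>

definition contract_cochain ::
  "nat \<Rightarrow> ((dihedral \<Rightarrow>\<^sub>0 complex) list \<Rightarrow> complex) \<Rightarrow> (dihedral \<Rightarrow>\<^sub>0 complex) list \<Rightarrow> complex" where
  "contract_cochain m \<phi> xs =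
     (if length xs = m + 2
      then lift (contraction (\<lambda>x y z. \<phi> (hd xs * grp_elem x # grp_elem y # grp_elem z # drop 2 xs))) (xs ! 1)
      else 0)"

lemma cochain_contract:
  assumes \<phi>: "\<phi> \<in> cochains grp_scale (m + 2)"
  shows "contract_cochain m \<phi> \<in> cochains grp_scale (m + 1)"
proof -
  define \<tau> where "\<tau> u ys x y z = \<phi> (u * grp_elem x # grp_elem y # grp_elem z # ys)" for u ys x y z
  have hd: "\<tau> (u + u') ys = (\<lambda>x y z. \<tau> u ys x y z + \<tau> u' ys x y z)"
      "\<tau> (grp_scale c u) ys = (\<lambda>x y z. c * \<tau> u ys x y z)"
    if "length ys = m" for u u' c ys
  proof -
    have "\<phi> ((v + v') # zs) = \<phi> (v # zs) + \<phi> (v' # zs)" "\<phi> (grp_scale c v # zs) = c * \<phi> (v # zs)"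
      if "length zs = m + 2" for v v' zs
      using \<phi> that unfolding grp.cochains_iff
      by (metis (no_types, lifting) Suc_eq_plus1 length_Cons list_update_code(2) zero_less_Suc)+
    then show "\<tau> (u + u') ys = (\<lambda>x y z. \<tau> u ys x y z + \<tau> u' ys x y z)"
      "\<tau> (grp_scale c u) ys = (\<lambda>x y z. c * \<tau> u ys x y z)"
      using that by (auto simp: \<tau>_def fun_eq_iff distrib_right grp.mult_scale_left)
  qed
  have tl: "\<tau> u (ys[i := v + v']) = (\<lambda>x y z. \<tau> u (ys[i := v]) x y z + \<tau> u (ys[i := v']) x y z)"
      "\<tau> u (ys[i := grp_scale c v]) = (\<lambda>x y z. c * \<tau> u (ys[i := v]) x y z)"
    if "length ys = m" "i < m" for u v v' c ys i
  proof -
    have l: "length (p # q # r # ys) = m + 2 + 1 \<and> Suc (Suc (Suc i)) < m + 2 + 1" for p q r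
      using that by simp
    have "\<phi> ((p # q # r # ys)[Suc (Suc (Suc i)) := v + v']) =
        \<phi> ((p # q # r # ys)[Suc (Suc (Suc i)) := v]) + \<phi> ((p # q # r # ys)[Suc (Suc (Suc i)) := v'])"
      "\<phi> ((p # q # r # ys)[Suc (Suc (Suc i)) := grp_scale c v]) =
        c * \<phi> ((p # q # r # ys)[Suc (Suc (Suc i)) := v])" for p q r
      using \<phi>[unfolded grp.cochains_iff] l[of p q r] by blast+
    then show "\<tau> u (ys[i := v + v']) = (\<lambda>x y z. \<tau> u (ys[i := v]) x y z + \<tau> u (ys[i := v']) x y z)"
      "\<tau> u (ys[i := grp_scale c v]) = (\<lambda>x y z. c * \<tau> u (ys[i := v]) x y z)"
      by (simp_all add: \<tau>_def fun_eq_iff)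
  qed
  have comb: "contraction (\<lambda>x y z. \<tau>1 x y z + \<tau>2 x y z) = (\<lambda>g. contraction \<tau>1 g + contraction \<tau>2 g)"
    "contraction (\<lambda>x y z. c * \<tau>1 x y z) = (\<lambda>g. c * contraction \<tau>1 g)" for c \<tau>1 \<tau>2
    using contraction_comb[of 1 \<tau>1 1 \<tau>2] contraction_comb[of c \<tau>1 0 \<tau>1] by auto
  have lift_comb': "lift (\<lambda>g. f g + f' g) a = lift f a + lift f' a" "lift (\<lambda>g. c * f g) a = c * lift f a"
    for c a and f f' :: "dihedral \<Rightarrow> complex"
    using lift_comb[of 1 f 1 f' a] lift_comb[of c f 0 f a] by simp_all
  have val: "contract_cochain m \<phi> (u # v # ys) = lift (contraction (\<tau> u ys)) v" if "length ys = m" for u v ys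
    using that by (simp add: contract_cochain_def \<tau>_def[abs_def])
  show ?thesis
    unfolding grp.cochains_iff
  proof (intro conjI allI impI)
    fix xs :: "(dihedral \<Rightarrow>\<^sub>0 complex) list" and i x y c
    assume i: "length xs = m + 1 + 1 \<and> i < m + 1 + 1"
    then obtain u v ys where xs: "xs = u # v # ys" "length ys = m"
      by (auto simp: length_Suc_conv)
    consider "i = 0" | "i = 1" | k where "i = k + 2" "k < m"
      using i by (cases i; cases "i - 1") auto
    then show "contract_cochain m \<phi> (xs[i := x + y]) = contract_cochain m \<phi> (xs[i := x]) + contract_cochain m \<phi> (xs[i := y])"
      by cases (use xs in \<open>simp_all add: val hd tl comb lift_comb' lift_add\<close>)
    consider "i = 0" | "i = 1" | k where "i = k + 2" "k < m"
      using i by (cases i; cases "i - 1") auto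
    then show "contract_cochain m \<phi> (xs[i := grp_scale c x]) = c * contract_cochain m \<phi> (xs[i := x])"
      by cases (use xs in \<open>simp_all add: val hd tl comb lift_comb' lift_scale\<close>)
  qed (simp add: contract_cochain_def)
qed

text \<open>
  A face of index \<open>\<ge> 2\<close> of \<open>a\<^sub>0 \<otimes> a\<^sub>1 \<otimes> a\<^sub>2 \<otimes> \<dots>\<close> changes only \<open>a\<^sub>0\<close> by a left
  factor and the part after \<open>a\<^sub>1\<close>, so these faces commute with the replacement of \<open>a\<^sub>1\<close> by
  elements of \<open>A \<otimes> A \<otimes> A\<close>.
\<close>

lemma face_prefix:
  assumes "length ys = m + 1" "i \<le> m"
  shows "\<exists>u' ys'. face (i + 2) (u # v # ys) = u' # v # ys' \<and> length ys' = m \<and>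
    face (i + 3) (u * p # q # r # ys) = u' * p # q # r # ys'"
proof (cases "i < m")
  case True
  have 3: "i + 3 = Suc (Suc (Suc i))" "i + 2 = Suc (Suc i)" by simp_all
  show ?thesis
    using assms True unfolding face_def merge_def 3
    by (intro exI[of _ u] exI[of _ "take i ys @ ys ! i * ys ! Suc i # drop (i + 2) ys"]) simp
next
  case False
  then have i: "i = m" using assms by simp
  show ?thesis
    using assms unfolding i face_def
    by (intro exI[of _ "last ys * u"] exI[of _ "butlast ys"]) (auto simp: mult.assoc)
qed

text \<open>
  On group elements, apply the contraction at \<open>g\<^sub>1\<close> to the cocycle identity for
  \<open>(g\<^sub>0 x, y, z, g\<^sub>2, \<dots>)\<close>, as a functional of \<open>(x, y, z)\<close>. The faces of index \<open>\<ge> 3\<close> give the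
  faces of index \<open>\<ge> 2\<close> of the contracted cochain, those of index \<open>0\<close> and \<open>1\<close> form a boundary
  in \<open>(x, y, z)\<close>, and the one of index \<open>2\<close> combines with the faces \<open>0\<close> and \<open>1\<close> of the
  contracted cochain by the derivation rule.
\<close>

lemma hochschild_vanishing:
  fixes \<phi> :: "(dihedral \<Rightarrow>\<^sub>0 complex) list \<Rightarrow> complex"
  assumes \<phi>: "\<phi> \<in> cochains grp_scale (m + 2)" and b: "hochschild_b (m + 2) \<phi> = (\<lambda>_. 0)"
  shows "hochschild_b (m + 1) (contract_cochain m \<phi>) = \<phi>"
proof (rule cochain_ext)
  show "hochschild_b (m + 1) (contract_cochain m \<phi>) \<in> cochains grp_scale (m + 2)"
    using grp.cochain_b[OF cochain_contract[OF \<phi>]] by simp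
  fix gs :: "dihedral list" assume gs: "length gs = m + 2 + 1"
  then obtain g0 g1 g2 hs where gs: "gs = g0 # g1 # g2 # hs" "length hs = m"
    by (auto simp: length_Suc_conv numeral_2_eq_2)
  define rest where "rest = map grp_elem hs"
  define ys where "ys = grp_elem g2 # rest"
  define xs where "xs = grp_elem g0 # grp_elem g1 # ys"
  have xs: "map grp_elem gs = xs" by (simp add: gs xs_def ys_def rest_def)
  have len: "length rest = m" "length ys = m + 1" "length xs = m + 3"
    using gs by (simp_all add: xs_def ys_def rest_def)
  define L where "L x y z = grp_elem g0 * grp_elem x # grp_elem y # grp_elem z # ys" for x y z
  define \<tau> where "\<tau> x y z = \<phi> (grp_elem g0 * grp_elem x # grp_elem y # grp_elem z # rest)" for x y z
  define \<sigma> where "\<sigma> x z = \<phi> (grp_elem g0 * grp_elem x # grp_elem z # ys)" for x z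
  have lL: "length (L x y z) = m + 4" for x y z by (simp add: L_def len)
  have h: "contract_cochain m \<phi> (face (i + 2) xs) = contraction (\<lambda>x y z. \<phi> (face (i + 3) (L x y z))) g1"
    if im: "i \<le> m" for i
  proof -
    have "(\<lambda>x y z. \<phi> (hd (face (i + 2) xs) * grp_elem x # grp_elem y # grp_elem z # drop 2 (face (i + 2) xs)))
        = (\<lambda>x y z. \<phi> (face (i + 3) (L x y z)))"
    proof (intro ext)
      fix x y z
      obtain u' ys' where *: "face (i + 2) xs = u' # grp_elem g1 # ys'"
        "face (i + 3) (L x y z) = u' * grp_elem x # grp_elem y # grp_elem z # ys'"
        using face_prefix[OF len(2) im] unfolding xs_def L_def by blast
      show "\<phi> (hd (face (i + 2) xs) * grp_elem x # grp_elem y # grp_elem z # drop 2 (face (i + 2) xs))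
        = \<phi> (face (i + 3) (L x y z))" unfolding * by simp
    qed
    moreover have "face (i + 2) xs ! 1 = grp_elem g1" "length (face (i + 2) xs) = m + 2"
      using face_prefix[OF len(2) im] unfolding xs_def by (metis nth_Cons_0 nth_Cons_Suc One_nat_def)
        (simp add: length_face len)
    ultimately show ?thesis
      by (simp add: contract_cochain_def lift_grp_elem)
  qed
  have f012: "\<phi> (face 0 (L x y z)) = \<sigma> (x + y) z" "\<phi> (face 1 (L x y z)) = \<sigma> x (y + z)"
    "\<phi> (face 2 (L x y z)) = \<tau> x y (z + g2)" for x y z
    by (simp_all add: L_def \<sigma>_def \<tau>_def face_def merge_def ys_def grp_elem_mult mult.assoc add.assoc numeral_2_eq_2)
  have "(\<Sum>i\<le>m. (-1) ^ i * \<phi> (face (i + 3) (L x y z))) =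
      1 * (\<sigma> (x + y) z - \<sigma> x (y + z)) + 1 * \<tau> x y (z + g2)" for x y z
  proof -
    have "0 = hochschild_b (m + 2) \<phi> (L x y z)" by (simp only: b)
    also have "\<dots> = (\<Sum>i\<le>Suc (Suc (Suc m)). (-1) ^ i * \<phi> (face i (L x y z)))"
      using lL by (simp add: hochschild_b_face del: sum.atMost_Suc)
    also have "\<dots> = \<phi> (face 0 (L x y z)) - \<phi> (face 1 (L x y z)) + \<phi> (face 2 (L x y z)) -
        (\<Sum>i\<le>m. (-1) ^ i * \<phi> (face (i + 3) (L x y z)))"
      by (simp add: sum.atMost_Suc_shift sum_negf numeral_2_eq_2 numeral_3_eq_3 del: sum.atMost_Suc)
    finally show ?thesis unfolding f012 by (simp add: algebra_simps)
  qed
  then have "(\<lambda>x y z. \<Sum>i\<le>m. (-1) ^ i * \<phi> (face (i + 3) (L x y z))) =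
      (\<lambda>x y z. 1 * (\<sigma> (x + y) z - \<sigma> x (y + z)) + 1 * \<tau> x y (z + g2))"
    by (intro ext)
  moreover have "(\<Sum>i\<le>m. (-1) ^ i * contract_cochain m \<phi> (face (i + 2) xs)) =
      (\<Sum>i\<le>m. (-1) ^ i * contraction (\<lambda>x y z. \<phi> (face (i + 3) (L x y z))) g1)"
    by (intro sum.cong refl) (simp only: h atMost_iff)
  ultimately have "(\<Sum>i\<le>m. (-1) ^ i * contract_cochain m \<phi> (face (i + 2) xs)) =
      contraction (\<lambda>x y z. 1 * (\<sigma> (x + y) z - \<sigma> x (y + z)) + 1 * \<tau> x y (z + g2)) g1"
    using contraction_sum[of "{..m}" "\<lambda>i. (-1) ^ i" "\<lambda>i x y z. \<phi> (face (i + 3) (L x y z))" g1]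
    by simp
  also have "\<dots> = \<sigma> 0 g1 - \<sigma> g1 0 + contraction (\<lambda>x y z. \<tau> x y (z + g2)) g1"
    by (simp only: contraction_comb contraction_boundary) simp
  finally have tail: "(\<Sum>i\<le>m. (-1) ^ i * contract_cochain m \<phi> (face (i + 2) xs)) =
      \<sigma> 0 g1 - \<sigma> g1 0 + contraction (\<lambda>x y z. \<tau> x y (z + g2)) g1" .
  have "face 0 xs = grp_elem (g0 + g1) # grp_elem g2 # rest" "face 1 xs = grp_elem g0 # grp_elem (g1 + g2) # rest"
    by (simp_all add: xs_def ys_def face_def merge_def grp_elem_mult)
  then have f01: "contract_cochain m \<phi> (face 0 xs) = contraction (\<lambda>x. \<tau> (g1 + x)) g2"
    "contract_cochain m \<phi> (face 1 xs) = contraction \<tau> (g1 + g2)"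
    using len by (simp_all add: contract_cochain_def lift_grp_elem \<tau>_def[abs_def] grp_elem_mult add.assoc)
  have "hochschild_b (m + 1) (contract_cochain m \<phi>) xs =
      (\<Sum>i\<le>Suc (Suc m). (-1) ^ i * contract_cochain m \<phi> (face i xs))"
    using len by (simp add: hochschild_b_face del: sum.atMost_Suc)
  also have "\<dots> = contract_cochain m \<phi> (face 0 xs) - contract_cochain m \<phi> (face 1 xs) +
      (\<Sum>i\<le>m. (-1) ^ i * contract_cochain m \<phi> (face (i + 2) xs))"
    by (simp add: sum.atMost_Suc_shift numeral_2_eq_2 del: sum.atMost_Suc)
  also have "\<dots> = \<tau> g1 0 g2 + \<sigma> 0 g1 - \<sigma> g1 0"
    unfolding f01 tail contraction_add by simp
  also have "\<dots> = \<phi> xs"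
    by (simp add: \<tau>_def \<sigma>_def xs_def ys_def)
  finally show "hochschild_b (m + 1) (contract_cochain m \<phi>) (map grp_elem gs) = \<phi> (map grp_elem gs)"
    by (simp add: xs)
qed (rule \<phi>)

section \<open>Traces on conjugacy classes of infinite order\<close>

lemma connes_S_0: "connes_S 0 (cochain_of \<psi>) [a, b, c] = \<psi> (a * b * c)"
  by (simp add: connes_S_def merge_def cochain_of_def mult.assoc)

text \<open>
  For \<open>S\<^sup>a S\<^sup>b = S\<^sup>k\<close> with \<open>k \<noteq> 0\<close>, give the pair of factors the weight
  \<open>(a - b) / k\<close>. This is antisymmetric, and the signed weights of the three faces of a triple with
  product \<open>S\<^sup>k\<close> add up to \<open>1\<close>. So the trace times this weight is a cyclic cochain with
  coboundary \<open>S \<psi>\<close>. Written as \<open>2 a / k - 1\<close>, the weight also fits products of two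
  reflections. On products that are reflections or the unit, where \<open>k\<close> may be zero, the trace
  vanishes.
\<close>

lemma connes_S_trace_coboundary:
  fixes \<psi> :: "(dihedral \<Rightarrow>\<^sub>0 complex) \<Rightarrow> complex"
  assumes \<psi>: "cyclic_0_cocycle grp_scale \<psi>" "\<psi> 1 = 0" "\<And>m. \<psi> (grp_elem (Dih m True)) = 0"
  shows "connes_S 0 (cochain_of \<psi>) \<in> hochschild_b 1 ` cyclic_cochains grp_scale 1"
proof -
  define t where "t g = \<psi> (grp_elem g)" for g
  define ratio :: "dihedral \<Rightarrow> dihedral \<Rightarrow> complex" where
    "ratio g h = 2 * of_int (rot g) / of_int (rot (g + h)) - 1" for g h
  define \<eta> where "\<eta> xs = (if length xs = 1 + 1
    then lift (\<lambda>g. lift (\<lambda>h. t (g + h) * ratio g h) (xs ! 1)) (hd xs) else 0)" for xs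
  have conj: "t (g + h) = t (h + g)" for g h
    using \<psi>(1) unfolding t_def cyclic_0_cocycle_def by (metis mult_single mult_1)
  have t0: "t g = 0" if "flip g \<or> rot g = 0" for g
  proof (cases g)
    case (Dih m b)
    have "Dih 0 False = 0" by (simp add: zero_dihedral_def)
    then show ?thesis using that Dih \<psi> by (cases b) (auto simp: t_def)
  qed
  have \<eta>: "\<eta> \<in> cochains grp_scale 1"
    unfolding grp.cochains_iff
  proof (intro conjI allI impI)
    fix xs :: "(dihedral \<Rightarrow>\<^sub>0 complex) list" and i :: nat
      and x y :: "dihedral \<Rightarrow>\<^sub>0 complex" and c
    assume i: "length xs = 1 + 1 \<and> i < 1 + 1"
    then obtain u v where xs: "xs = [u, v]" by (auto simp: length_Suc_conv)
    have i: "i = 0 \<or> i = 1" using i by auto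
    have "lift (\<lambda>g. lift (f g) (x + y)) u = lift (\<lambda>g. lift (f g) x) u + lift (\<lambda>g. lift (f g) y) u" for f
      using lift_comb[of 1 "\<lambda>g. lift (f g) x" 1 "\<lambda>g. lift (f g) y" u] by (simp add: lift_add)
    then show "\<eta> (xs[i := x + y]) = \<eta> (xs[i := x]) + \<eta> (xs[i := y])"
      using i by (auto simp: \<eta>_def xs lift_add)
    have "lift (\<lambda>g. lift (f g) (grp_scale c x)) u = c * lift (\<lambda>g. lift (f g) x) u" for f
      using lift_comb[of c "\<lambda>g. lift (f g) x" 0 "\<lambda>g. lift (f g) x" u] by (simp add: lift_scale)
    then show "\<eta> (xs[i := grp_scale c x]) = c * \<eta> (xs[i := x])"
      using i by (auto simp: \<eta>_def xs lift_scale)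
  qed (simp add: \<eta>_def)
  have val: "\<eta> [grp_elem g, grp_elem h] = t (g + h) * ratio g h" for g h
    by (simp add: \<eta>_def lift_grp_elem)
  have rot: "rot (g + h) = rot g + (if flip g then - rot h else rot h)" "flip (g + h) = (flip g \<noteq> flip h)"
    for g h :: dihedral by (simp_all add: plus_dihedral_def)
  have anti: "t (h + g) * ratio h g = - (t (g + h) * ratio g h)" for g h
  proof (cases "flip (g + h) \<or> rot (g + h) = 0")
    case True
    then show ?thesis using t0[of "g + h"] conj[of h g] by simp
  next
    case False
    define k :: complex where "k = of_int (rot (g + h))"
    have k: "k \<noteq> 0" using False by (simp add: k_def)
    have "ratio h g = - ratio g h"
    proof (cases "flip g")
      case True
      then have "of_int (rot g) = k + of_int (rot h)" "of_int (rot (h + g)) = - k"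
        using False by (auto simp: k_def rot)
      then show ?thesis
        using k by (simp add: ratio_def field_simps flip: k_def)
    next
      case F: False
      then have "of_int (rot g) = k - of_int (rot h)" "of_int (rot (h + g)) = k"
        using False by (auto simp: k_def rot)
      then have "ratio g h = 2 * (k - of_int (rot h)) / k - 1" "ratio h g = 2 * of_int (rot h) / k - 1"
        by (simp_all only: ratio_def k_def[symmetric])
      then show ?thesis
        using k by (simp add: diff_divide_distrib right_diff_distrib)
    qed
    then show ?thesis using conj[of g h] by simp
  qed
  have "cyc 1 \<eta> = \<eta>"
  proof (rule cochain_ext[OF grp.cochain_cyc[OF \<eta>] \<eta>])
    fix gs :: "dihedral list" assume "length gs = 1 + 1"
    then obtain g h where "gs = [g, h]" by (auto simp: length_Suc_conv)
    then show "cyc 1 \<eta> (map grp_elem gs) = \<eta> (map grp_elem gs)"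
      using anti[of g h] by (simp add: cyc_def val)
  qed
  then have cyc\<eta>: "\<eta> \<in> cyclic_cochains grp_scale 1" using \<eta> by (simp add: grp.cyclic_cochains_iff)
  have "cochain_of \<psi> \<in> cyclic_cocycles grp_scale 0" using \<psi> by (simp add: cochain_of_cocycle_iff)
  from grp.connes_S_cocycle[OF this]
  have S: "connes_S 0 (cochain_of \<psi>) \<in> cochains grp_scale 2"
    by (simp add: cyclic_cocycles_def grp.cyclic_cochains_iff numeral_2_eq_2)
  have b\<eta>: "hochschild_b 1 \<eta> \<in> cochains grp_scale 2"
    using grp.cochain_b[OF \<eta>] by (simp add: numeral_2_eq_2)
  have "hochschild_b 1 \<eta> = connes_S 0 (cochain_of \<psi>)"
  proof (rule cochain_ext[OF b\<eta> S])
    fix gs :: "dihedral list" assume "length gs = 2 + 1"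
    then obtain g h k where gs: "gs = [g, h, k]" by (auto simp: length_Suc_conv numeral_2_eq_2)
    have "hochschild_b 1 \<eta> (map grp_elem gs) =
        t (g + h + k) * ratio (g + h) k - t (g + (h + k)) * ratio g (h + k) + t (k + g + h) * ratio (k + g) h"
      by (simp add: gs hochschild_b_def merge_def grp_elem_mult val)
    also have "\<dots> = t (g + h + k) * (ratio (g + h) k - ratio g (h + k) + ratio (k + g) h)"
      using conj[of k "g + h"] by (simp add: add.assoc algebra_simps)
    also have "\<dots> = t (g + h + k)"
    proof (cases "flip (g + h + k) \<or> rot (g + h + k) = 0")
      case True
      then show ?thesis using t0 by simp
    next
      case False
      have r: "rot (k + g + h) = (if flip k then - rot (g + h + k) else rot (g + h + k))"
        using False by (auto simp: rot)
      have "ratio (g + h) k - ratio g (h + k) + ratio (k + g) h = 1"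
      proof -
        define K :: complex where "K = of_int (rot (g + h + k))"
        have K: "K \<noteq> 0" using False by (simp add: K_def)
        define C :: complex where "C = (if flip k then - of_int (rot (k + g)) else of_int (rot (k + g)))"
        have N: "of_int (rot (g + h)) - of_int (rot g) + C = K"
          using False by (auto simp: K_def C_def rot)
        have "ratio (g + h) k = 2 * of_int (rot (g + h)) / K - 1" "ratio g (h + k) = 2 * of_int (rot g) / K - 1"
          by (simp_all add: ratio_def K_def add.assoc)
        moreover have "ratio (k + g) h = 2 * C / K - 1"
          unfolding ratio_def r by (simp add: C_def K_def)
        ultimately have "ratio (g + h) k - ratio g (h + k) + ratio (k + g) h =
            2 * (of_int (rot (g + h)) - of_int (rot g) + C) / K - 1"
          by (simp add: add_divide_distrib diff_divide_distrib distrib_left right_diff_distrib)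
        then show ?thesis using K unfolding N by simp
      qed
      then show ?thesis by simp
    qed
    also have "\<dots> = connes_S 0 (cochain_of \<psi>) (map grp_elem gs)"
      by (simp add: gs connes_S_0 grp_elem_mult t_def)
    finally show "hochschild_b 1 \<eta> (map grp_elem gs) = connes_S 0 (cochain_of \<psi>) (map grp_elem gs)" .
  qed
  then show ?thesis using cyc\<eta> by (metis image_eqI)
qed


section \<open>Cohomology groups as spaces of cosets\<close>

context complex_algebra
begin

lemma cyclic_cocycles_comb:
  assumes "\<phi> \<in> cyclic_cocycles s n" "\<psi> \<in> cyclic_cocycles s n"
  shows "(\<lambda>xs. c * \<phi> xs + d * \<psi> xs) \<in> cyclic_cocycles s n"
proof -
  have "hochschild_b n (\<lambda>xs. c * \<phi> xs + d * \<psi> xs) = (\<lambda>_. 0)"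
    using assms by (intro ext) (simp add: b_comb cyclic_cocycles_def)
  then show ?thesis
    using assms by (simp add: cyclic_cocycles_def cyclic_cochains_comb)
qed

lemma cyclic_coboundaries_comb:
  assumes "\<phi> \<in> cyclic_coboundaries s n" "\<psi> \<in> cyclic_coboundaries s n"
  shows "(\<lambda>xs. c * \<phi> xs + d * \<psi> xs) \<in> cyclic_coboundaries s n"
proof (cases n)
  case 0
  then show ?thesis using assms by (simp add: cyclic_coboundaries_def)
next
  case (Suc m)
  then obtain \<kappa> \<mu> where "\<kappa> \<in> cyclic_cochains s m" "\<mu> \<in> cyclic_cochains s m"
    "\<phi> = hochschild_b m \<kappa>" "\<psi> = hochschild_b m \<mu>"
    using assms by (auto simp: cyclic_coboundaries_def)
  then have "(\<lambda>xs. c * \<phi> xs + d * \<psi> xs) = hochschild_b m (\<lambda>xs. c * \<kappa> xs + d * \<mu> xs)"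
    "(\<lambda>xs. c * \<kappa> xs + d * \<mu> xs) \<in> cyclic_cochains s m"
    by (auto simp: b_comb intro: cyclic_cochains_comb)
  then show ?thesis using Suc by (auto simp: cyclic_coboundaries_def)
qed

lemma cyclic_coboundaries_zero: "(\<lambda>_. 0) \<in> cyclic_coboundaries s n"
proof (cases n)
  case (Suc m)
  have "(\<lambda>_. 0) \<in> cyclic_cochains s m"
    by (simp add: cyclic_cochains_iff cochains_zero cyc_def fun_eq_iff)
  then have "(\<lambda>_. 0) \<in> hochschild_b m ` cyclic_cochains s m"
    by (intro image_eqI[of _ _ "\<lambda>_. 0"]) (simp_all add: b_zero)
  then show ?thesis using Suc by (simp add: cyclic_coboundaries_def)
qed (simp add: cyclic_coboundaries_def)

lemma connes_S_coboundaries: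
  assumes "\<beta> \<in> cyclic_coboundaries s n"
  shows "connes_S n \<beta> \<in> cyclic_coboundaries s (n + 2)"
proof (cases n)
  case 0
  then have "connes_S n \<beta> = (\<lambda>_. 0)"
    using assms by (auto simp: cyclic_coboundaries_def connes_S_def)
  then show ?thesis using cyclic_coboundaries_zero by simp
next
  case (Suc m)
  then obtain \<eta> where "\<eta> \<in> cyclic_cochains s m" "\<beta> = hochschild_b m \<eta>"
    using assms by (auto simp: cyclic_coboundaries_def)
  then show ?thesis using connes_S_coboundary[of \<eta> m] Suc by (simp add: cyclic_coboundaries_def)
qed

text \<open>
  The cosets are handled through the difference of representatives, which turns equations between
  classes into membership in the space of coboundaries.
\<close>

lemma mem_HC_class:
  "\<phi>' \<in> HC_class s n \<phi> \<longleftrightarrow> (\<lambda>xs. \<phi>' xs - \<phi> xs) \<in> cyclic_coboundaries s n"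
proof -
  have "\<phi>' \<in> HC_class s n \<phi> \<longleftrightarrow> (\<exists>\<beta>\<in>cyclic_coboundaries s n. \<phi>' = (\<lambda>xs. \<beta> xs + \<phi> xs))"
    by (auto simp: HC_class_def a_r_coset_def' cocycle_space_def)
  also have "\<dots> \<longleftrightarrow> (\<lambda>xs. \<phi>' xs - \<phi> xs) \<in> cyclic_coboundaries s n"
    by (auto simp: fun_eq_iff intro!: bexI[of _ "\<lambda>xs. \<phi>' xs - \<phi> xs"])
  finally show ?thesis .
qed

lemma HC_class_eq_iff:
  "HC_class s n \<phi> = HC_class s n \<psi> \<longleftrightarrow> (\<lambda>xs. \<phi> xs - \<psi> xs) \<in> cyclic_coboundaries s n"
proof
  assume "HC_class s n \<phi> = HC_class s n \<psi>"
  moreover have "\<phi> \<in> HC_class s n \<phi>" by (simp add: mem_HC_class cyclic_coboundaries_zero)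
  ultimately show "(\<lambda>xs. \<phi> xs - \<psi> xs) \<in> cyclic_coboundaries s n" by (simp add: mem_HC_class)
next
  assume *: "(\<lambda>xs. \<phi> xs - \<psi> xs) \<in> cyclic_coboundaries s n"
  have "(\<lambda>xs. \<theta> xs - \<phi> xs) \<in> cyclic_coboundaries s n \<longleftrightarrow> (\<lambda>xs. \<theta> xs - \<psi> xs) \<in> cyclic_coboundaries s n" for \<theta>
    using cyclic_coboundaries_comb[OF _ *, of "\<lambda>xs. \<theta> xs - \<phi> xs" 1 1]
      cyclic_coboundaries_comb[OF _ *, of "\<lambda>xs. \<theta> xs - \<psi> xs" 1 "-1"] by auto
  then show "HC_class s n \<phi> = HC_class s n \<psi>" by (auto simp: mem_HC_class)
qed

lemma carrier_HC: "carrier (HC s n) = HC_class s n ` cyclic_cocycles s n"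
  by (auto simp: HC_def quot_space_def A_RCOSETS_def' HC_class_def cocycle_space_def)

lemma HC_add:
  "HC_class s n \<phi> \<oplus>\<^bsub>HC s n\<^esub> HC_class s n \<psi> = HC_class s n (\<lambda>xs. \<phi> xs + \<psi> xs)"
proof -
  have "HC_class s n \<phi> \<oplus>\<^bsub>HC s n\<^esub> HC_class s n \<psi> =
      {\<theta>. \<exists>\<phi>'\<in>HC_class s n \<phi>. \<exists>\<psi>'\<in>HC_class s n \<psi>. \<theta> = (\<lambda>xs. \<phi>' xs + \<psi>' xs)}"
    by (auto simp: HC_def quot_space_def set_add_def' cocycle_space_def)
  also have "\<dots> = HC_class s n (\<lambda>xs. \<phi> xs + \<psi> xs)"
  proof (intro equalityI subsetI)
    fix \<theta> assume "\<theta> \<in> {\<theta>. \<exists>\<phi>'\<in>HC_class s n \<phi>. \<exists>\<psi>'\<in>HC_class s n \<psi>. \<theta> = (\<lambda>xs. \<phi>' xs + \<psi>' xs)}"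
    then obtain \<phi>' \<psi>' where *: "\<phi>' \<in> HC_class s n \<phi>" "\<psi>' \<in> HC_class s n \<psi>" "\<theta> = (\<lambda>xs. \<phi>' xs + \<psi>' xs)"
      by blast
    then show "\<theta> \<in> HC_class s n (\<lambda>xs. \<phi> xs + \<psi> xs)"
      using cyclic_coboundaries_comb[of "\<lambda>xs. \<phi>' xs - \<phi> xs" n "\<lambda>xs. \<psi>' xs - \<psi> xs" 1 1]
      by (simp add: mem_HC_class algebra_simps)
  next
    fix \<theta> assume "\<theta> \<in> HC_class s n (\<lambda>xs. \<phi> xs + \<psi> xs)"
    then have "(\<lambda>xs. \<theta> xs - \<psi> xs) \<in> HC_class s n \<phi>" by (simp add: mem_HC_class algebra_simps)
    moreover have "\<psi> \<in> HC_class s n \<psi>" by (simp add: mem_HC_class cyclic_coboundaries_zero)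
    ultimately show "\<theta> \<in> {\<theta>. \<exists>\<phi>'\<in>HC_class s n \<phi>. \<exists>\<psi>'\<in>HC_class s n \<psi>. \<theta> = (\<lambda>xs. \<phi>' xs + \<psi>' xs)}"
      by (intro CollectI bexI[of _ "\<lambda>xs. \<theta> xs - \<psi> xs"] bexI[of _ \<psi>]) auto
  qed
  finally show ?thesis .
qed

lemma HC_smult: "c \<odot>\<^bsub>HC s n\<^esub> HC_class s n \<phi> = HC_class s n (\<lambda>xs. c * \<phi> xs)"
proof -
  have "c \<odot>\<^bsub>HC s n\<^esub> HC_class s n \<phi> = (\<Union>\<phi>'\<in>HC_class s n \<phi>. HC_class s n (\<lambda>xs. c * \<phi>' xs))"
    by (simp add: HC_def quot_space_def HC_class_def cocycle_space_def)
  also have "\<dots> = (\<Union>\<phi>'\<in>HC_class s n \<phi>. HC_class s n (\<lambda>xs. c * \<phi> xs))"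
  proof (rule SUP_cong[OF refl])
    fix \<phi>' assume "\<phi>' \<in> HC_class s n \<phi>"
    then show "HC_class s n (\<lambda>xs. c * \<phi>' xs) = HC_class s n (\<lambda>xs. c * \<phi> xs)"
      using cyclic_coboundaries_comb[of "\<lambda>xs. \<phi>' xs - \<phi> xs" n "\<lambda>xs. \<phi>' xs - \<phi> xs" c 0]
      by (simp add: HC_class_eq_iff mem_HC_class right_diff_distrib)
  qed
  also have "\<dots> = HC_class s n (\<lambda>xs. c * \<phi> xs)"
    using mem_HC_class[of \<phi> n \<phi>] cyclic_coboundaries_zero by auto
  finally show ?thesis .
qed

lemma HC_S_class: "HC_S s n (HC_class s n \<phi>) = HC_class s (n + 2) (connes_S n \<phi>)"
proof -
  have "HC_S s n (HC_class s n \<phi>) = (\<Union>\<phi>'\<in>HC_class s n \<phi>. HC_class s (n + 2) (connes_S n \<phi>))"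
    unfolding HC_S_def
  proof (rule SUP_cong[OF refl])
    fix \<phi>' assume "\<phi>' \<in> HC_class s n \<phi>"
    then have "connes_S n (\<lambda>xs. \<phi>' xs - \<phi> xs) \<in> cyclic_coboundaries s (n + 2)"
      by (intro connes_S_coboundaries) (simp add: mem_HC_class)
    moreover have "connes_S n (\<lambda>xs. \<phi>' xs - \<phi> xs) = (\<lambda>xs. connes_S n \<phi>' xs - connes_S n \<phi> xs)"
      using connes_S_comb[of n 1 \<phi>' "-1" \<phi>] by (intro ext) simp
    ultimately show "HC_class s (n + 2) (connes_S n \<phi>') = HC_class s (n + 2) (connes_S n \<phi>)"
      by (simp add: HC_class_eq_iff)
  qed
  also have "\<dots> = HC_class s (n + 2) (connes_S n \<phi>)"
    using mem_HC_class[of \<phi> n \<phi>] cyclic_coboundaries_zero by auto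
  finally show ?thesis .
qed

end

section \<open>Direct limits\<close>

text \<open>
  The closure and linearity conditions that make the operations on a direct limit independent of the
  chosen representatives.
\<close>

locale linear_sequence =
  fixes M :: "nat \<Rightarrow> (complex, 'b) module" and f :: "nat \<Rightarrow> 'b \<Rightarrow> 'b"
  assumes map_closed: "x \<in> carrier (M i) \<Longrightarrow> f i x \<in> carrier (M (Suc i))"
    and add_closed: "x \<in> carrier (M i) \<Longrightarrow> y \<in> carrier (M i) \<Longrightarrow> x \<oplus>\<^bsub>M i\<^esub> y \<in> carrier (M i)"
    and smult_closed: "x \<in> carrier (M i) \<Longrightarrow> c \<odot>\<^bsub>M i\<^esub> x \<in> carrier (M i)"
    and map_add: "x \<in> carrier (M i) \<Longrightarrow> y \<in> carrier (M i) \<Longrightarrow>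
      f i (x \<oplus>\<^bsub>M i\<^esub> y) = f i x \<oplus>\<^bsub>M (Suc i)\<^esub> f i y"
    and map_smult: "x \<in> carrier (M i) \<Longrightarrow> f i (c \<odot>\<^bsub>M i\<^esub> x) = c \<odot>\<^bsub>M (Suc i)\<^esub> f i x"
begin

lemma fold_closed: "i \<le> k \<Longrightarrow> x \<in> carrier (M i) \<Longrightarrow> fold f [i..<k] x \<in> carrier (M k)"
  by (induction k rule: dec_induct) (simp_all add: map_closed)

lemma fold_add:
  "i \<le> k \<Longrightarrow> x \<in> carrier (M i) \<Longrightarrow> y \<in> carrier (M i) \<Longrightarrow>
    fold f [i..<k] (x \<oplus>\<^bsub>M i\<^esub> y) = fold f [i..<k] x \<oplus>\<^bsub>M k\<^esub> fold f [i..<k] y"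
  by (induction k rule: dec_induct) (simp_all add: map_add fold_closed)

lemma fold_smult:
  "i \<le> k \<Longrightarrow> x \<in> carrier (M i) \<Longrightarrow>
    fold f [i..<k] (c \<odot>\<^bsub>M i\<^esub> x) = c \<odot>\<^bsub>M k\<^esub> fold f [i..<k] x"
  by (induction k rule: dec_induct) (simp_all add: map_smult fold_closed)

lemma fold_trans: "i \<le> j \<Longrightarrow> j \<le> k \<Longrightarrow> fold f [j..<k] (fold f [i..<j] x) = fold f [i..<k] x"
  using upt_add_eq_append[of i j "k - j"] by simp

lemma mem_dirlim_in:
  "(j, y) \<in> dirlim_in M f i x \<longleftrightarrow> x \<in> carrier (M i) \<and> y \<in> carrier (M j) \<and>
    (\<exists>k. i \<le> k \<and> j \<le> k \<and> fold f [i..<k] x = fold f [j..<k] y)"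
  by (simp add: dirlim_in_def dirlim_rel_def)

lemma later_stage:
  assumes "fold f [i..<k] x = fold f [j..<k] y" "i \<le> k" "j \<le> k" "k \<le> l"
  shows "fold f [i..<l] x = fold f [j..<l] y"
  using assms fold_trans[of i k l x] fold_trans[of j k l y] by simp

lemma dirlim_in_eq_iff:
  assumes "x \<in> carrier (M i)" "y \<in> carrier (M j)"
  shows "dirlim_in M f i x = dirlim_in M f j y \<longleftrightarrow>
    (\<exists>k. i \<le> k \<and> j \<le> k \<and> fold f [i..<k] x = fold f [j..<k] y)"
proof
  assume "dirlim_in M f i x = dirlim_in M f j y"
  moreover have "(j, y) \<in> dirlim_in M f j y"
    unfolding mem_dirlim_in using assms by auto
  ultimately show "\<exists>k. i \<le> k \<and> j \<le> k \<and> fold f [i..<k] x = fold f [j..<k] y"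
    by (metis mem_dirlim_in)
next
  have sub: "dirlim_in M f i x \<subseteq> dirlim_in M f j y"
    if "x \<in> carrier (M i)" "y \<in> carrier (M j)" "i \<le> k" "j \<le> k" "fold f [i..<k] x = fold f [j..<k] y" for i j x y k
  proof
    fix p assume p: "p \<in> dirlim_in M f i x"
    obtain l z where lz: "p = (l, z)" by force
    with p obtain k' where k': "z \<in> carrier (M l)" "i \<le> k'" "l \<le> k'" "fold f [i..<k'] x = fold f [l..<k'] z"
      by (auto simp: mem_dirlim_in)
    have "fold f [j..<max k k'] y = fold f [l..<max k k'] z"
      using later_stage[of i k x j y "max k k'"] later_stage[of i k' x l z "max k k'"] that k' by simp
    then show "p \<in> dirlim_in M f j y"
      unfolding lz mem_dirlim_in using that k' by (intro conjI exI[of _ "max k k'"]) auto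
  qed
  assume "\<exists>k. i \<le> k \<and> j \<le> k \<and> fold f [i..<k] x = fold f [j..<k] y"
  then obtain k where "i \<le> k" "j \<le> k" "fold f [i..<k] x = fold f [j..<k] y" by blast
  then show "dirlim_in M f i x = dirlim_in M f j y"
    using sub[of x i y j k] sub[of y j x i k] assms by auto
qed

lemma carrier_dirlim: "carrier (dirlim M f) = {dirlim_in M f i x | i x. x \<in> carrier (M i)}"
  by (auto simp: dirlim_def quotient_def dirlim_in_def)

lemma dirlim_add:
  assumes x: "x \<in> carrier (M i)" and y: "y \<in> carrier (M i)"
  shows "dirlim_in M f i x \<oplus>\<^bsub>dirlim M f\<^esub> dirlim_in M f i y = dirlim_in M f i (x \<oplus>\<^bsub>M i\<^esub> y)"
proof -
  have eq: "dirlim_in M f (max j l) (fold f [j..<max j l] u \<oplus>\<^bsub>M (max j l)\<^esub> fold f [l..<max j l] v) =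
      dirlim_in M f i (x \<oplus>\<^bsub>M i\<^esub> y)"
    if uv: "(j, u) \<in> dirlim_in M f i x" "(l, v) \<in> dirlim_in M f i y" for j u l v
  proof -
    obtain k where k: "u \<in> carrier (M j)" "i \<le> k" "j \<le> k" "fold f [i..<k] x = fold f [j..<k] u"
      using uv by (auto simp: mem_dirlim_in)
    obtain k' where k': "v \<in> carrier (M l)" "i \<le> k'" "l \<le> k'" "fold f [i..<k'] y = fold f [l..<k'] v"
      using uv by (auto simp: mem_dirlim_in)
    define K where "K = max k k'"
    have K: "i \<le> K" "j \<le> K" "l \<le> K" "max j l \<le> K" using k k' by (auto simp: K_def)
    have "fold f [max j l..<K] (fold f [j..<max j l] u \<oplus>\<^bsub>M (max j l)\<^esub> fold f [l..<max j l] v) =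
        fold f [j..<K] u \<oplus>\<^bsub>M K\<^esub> fold f [l..<K] v"
      using K k k' by (simp add: fold_add fold_closed fold_trans)
    also have "\<dots> = fold f [i..<K] x \<oplus>\<^bsub>M K\<^esub> fold f [i..<K] y"
      using later_stage[OF k(4) k(2,3), of K] later_stage[OF k'(4) k'(2,3), of K] by (simp add: K_def)
    also have "\<dots> = fold f [i..<K] (x \<oplus>\<^bsub>M i\<^esub> y)"
      using K x y by (simp add: fold_add)
    finally show ?thesis
      using K k k' x y by (subst dirlim_in_eq_iff) (auto intro!: add_closed fold_closed)
  qed
  have "(i, x) \<in> dirlim_in M f i x" "(i, y) \<in> dirlim_in M f i y"
    using x y unfolding mem_dirlim_in by auto
  then have ne: "dirlim_in M f i x \<noteq> {}" "dirlim_in M f i y \<noteq> {}" by blast+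
  define D where "D j u = (\<Union>(l, v)\<in>dirlim_in M f i y. dirlim_in M f (max j l)
      (fold f [j..<max j l] u \<oplus>\<^bsub>M (max j l)\<^esub> fold f [l..<max j l] v))" for j u
  have "D j u = dirlim_in M f i (x \<oplus>\<^bsub>M i\<^esub> y)" if "(j, u) \<in> dirlim_in M f i x" for j u
    unfolding D_def by (rule SUP_eq_const[OF ne(2)]) (use eq[OF that] in \<open>auto split: prod.split\<close>)
  then have "(\<Union>(j, u)\<in>dirlim_in M f i x. D j u) = dirlim_in M f i (x \<oplus>\<^bsub>M i\<^esub> y)"
    by (intro SUP_eq_const[OF ne(1)]) (auto split: prod.split)
  then show ?thesis by (simp add: dirlim_def D_def)
qed

lemma dirlim_smult:
  assumes x: "x \<in> carrier (M i)"
  shows "c \<odot>\<^bsub>dirlim M f\<^esub> dirlim_in M f i x = dirlim_in M f i (c \<odot>\<^bsub>M i\<^esub> x)"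
proof -
  have eq: "dirlim_in M f j (c \<odot>\<^bsub>M j\<^esub> u) = dirlim_in M f i (c \<odot>\<^bsub>M i\<^esub> x)"
    if uv: "(j, u) \<in> dirlim_in M f i x" for j u
  proof -
    obtain k where k: "u \<in> carrier (M j)" "i \<le> k" "j \<le> k" "fold f [i..<k] x = fold f [j..<k] u"
      using uv by (auto simp: mem_dirlim_in)
    then have "fold f [j..<k] (c \<odot>\<^bsub>M j\<^esub> u) = fold f [i..<k] (c \<odot>\<^bsub>M i\<^esub> x)"
      using x by (simp add: fold_smult)
    then show ?thesis
      using k x by (subst dirlim_in_eq_iff) (auto intro!: smult_closed)
  qed
  have "(i, x) \<in> dirlim_in M f i x"
    using x unfolding mem_dirlim_in by auto
  then have ne: "dirlim_in M f i x \<noteq> {}" by blast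
  define D where "D j u = dirlim_in M f j (c \<odot>\<^bsub>M j\<^esub> u)" for j u
  have "D j u = dirlim_in M f i (c \<odot>\<^bsub>M i\<^esub> x)" if "(j, u) \<in> dirlim_in M f i x" for j u
    unfolding D_def by (rule eq[OF that])
  then have "(\<Union>(j, u)\<in>dirlim_in M f i x. D j u) = dirlim_in M f i (c \<odot>\<^bsub>M i\<^esub> x)"
    by (intro SUP_eq_const[OF ne]) (auto split: prod.split)
  then show ?thesis by (simp add: dirlim_def D_def)
qed

end

section \<open>Even periodic cyclic cohomology and traces\<close>

context complex_algebra
begin

lemma linear_sequence_HC: "linear_sequence (\<lambda>n. HC s (2 * n)) (\<lambda>n. HC_S s (2 * n))"
proof
  fix i x y c
  assume x: "x \<in> carrier (HC s (2 * i))"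
  then obtain \<phi> where \<phi>: "\<phi> \<in> cyclic_cocycles s (2 * i)" "x = HC_class s (2 * i) \<phi>"
    by (auto simp: carrier_HC)
  show "HC_S s (2 * i) x \<in> carrier (HC s (2 * Suc i))"
    using connes_S_cocycle[OF \<phi>(1)] by (simp add: \<phi> HC_S_class carrier_HC)
  show "c \<odot>\<^bsub>HC s (2 * i)\<^esub> x \<in> carrier (HC s (2 * i))"
    using cyclic_cocycles_comb[OF \<phi>(1) \<phi>(1), of c 0] by (simp add: \<phi> HC_smult carrier_HC)
  have "connes_S (2 * i) (\<lambda>xs. c * \<phi> xs) = (\<lambda>xs. c * connes_S (2 * i) \<phi> xs)"
    using connes_S_comb[of "2 * i" c \<phi> 0 \<phi>] by (intro ext) simp
  then show "HC_S s (2 * i) (c \<odot>\<^bsub>HC s (2 * i)\<^esub> x) = c \<odot>\<^bsub>HC s (2 * Suc i)\<^esub> HC_S s (2 * i) x"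
    using HC_smult[of "2 * i + 2" c] by (simp add: \<phi> HC_smult HC_S_class)
  assume "y \<in> carrier (HC s (2 * i))"
  then obtain \<psi> where \<psi>: "\<psi> \<in> cyclic_cocycles s (2 * i)" "y = HC_class s (2 * i) \<psi>"
    by (auto simp: carrier_HC)
  show "x \<oplus>\<^bsub>HC s (2 * i)\<^esub> y \<in> carrier (HC s (2 * i))"
    using cyclic_cocycles_comb[OF \<phi>(1) \<psi>(1), of 1 1] by (simp add: \<phi> \<psi> HC_add carrier_HC)
  have "connes_S (2 * i) (\<lambda>xs. \<phi> xs + \<psi> xs) = (\<lambda>xs. connes_S (2 * i) \<phi> xs + connes_S (2 * i) \<psi> xs)"
    using connes_S_comb[of "2 * i" 1 \<phi> 1 \<psi>] by (intro ext) simp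
  then show "HC_S s (2 * i) (x \<oplus>\<^bsub>HC s (2 * i)\<^esub> y) =
      HC_S s (2 * i) x \<oplus>\<^bsub>HC s (2 * Suc i)\<^esub> HC_S s (2 * i) y"
    using HC_add[of "2 * i + 2"] by (simp add: \<phi> \<psi> HC_add HC_S_class)
qed

end

sublocale complex_algebra \<subseteq> HC_seq: linear_sequence "\<lambda>n. HC s (2 * n)" "\<lambda>n. HC_S s (2 * n)"
  by (rule linear_sequence_HC)

primrec connes_S_power :: "nat \<Rightarrow> ('a::ring_1 list \<Rightarrow> complex) \<Rightarrow> 'a list \<Rightarrow> complex" where
  "connes_S_power 0 \<phi> = \<phi>"
| "connes_S_power (Suc k) \<phi> = connes_S (2 * k) (connes_S_power k \<phi>)"

lemma connes_S_power_sub: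
  "connes_S_power k (\<lambda>xs. \<phi> xs - \<psi> xs) = (\<lambda>xs. connes_S_power k \<phi> xs - connes_S_power k \<psi> xs)"
proof (induction k)
  case (Suc k)
  then show ?case
    using connes_S_comb[of "2 * k" 1 "connes_S_power k \<phi>" "-1" "connes_S_power k \<psi>"] by (intro ext) simp
qed simp

context complex_algebra
begin

lemma fold_HC_S: "fold (\<lambda>n. HC_S s (2 * n)) [0..<k] (HC_class s 0 \<phi>) = HC_class s (2 * k) (connes_S_power k \<phi>)"
proof (induction k)
  case (Suc k)
  then show ?case using HC_S_class[of "2 * k"] by simp
qed simp

lemma HC_even_class_eq_iff:
  assumes "cyclic_0_cocycle s \<psi>" "cyclic_0_cocycle s \<psi>'"
  shows "HC_even_class s \<psi> = HC_even_class s \<psi>' \<longleftrightarrow>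
    (\<exists>k. connes_S_power k (cochain_of (\<lambda>a. \<psi> a - \<psi>' a)) \<in> cyclic_coboundaries s (2 * k))"
proof -
  have c: "HC_class s 0 (cochain_of \<psi>) \<in> carrier (HC s (2 * 0))" if "cyclic_0_cocycle s \<psi>" for \<psi>
    using that by (simp add: carrier_HC cochain_of_cocycle_iff)
  have d: "cochain_of (\<lambda>a. \<psi> a - \<psi>' a) = (\<lambda>xs. cochain_of \<psi> xs - cochain_of \<psi>' xs)"
    by (auto simp: cochain_of_def fun_eq_iff split: list.splits)
  show ?thesis
    unfolding HC_even_class_def HC_seq.dirlim_in_eq_iff[OF c[OF assms(1)] c[OF assms(2)]]
    by (simp add: fold_HC_S HC_class_eq_iff d connes_S_power_sub)
qed

lemma HC_even_comb:
  assumes "cyclic_0_cocycle s \<psi>" "cyclic_0_cocycle s \<psi>'"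
  shows "HC_even_class s \<psi> \<oplus>\<^bsub>HC_even s\<^esub> HC_even_class s \<psi>' = HC_even_class s (\<lambda>a. \<psi> a + \<psi>' a)"
    and "c \<odot>\<^bsub>HC_even s\<^esub> HC_even_class s \<psi> = HC_even_class s (\<lambda>a. c * \<psi> a)"
proof -
  have c: "HC_class s 0 (cochain_of \<psi>) \<in> carrier (HC s (2 * 0))" if "cyclic_0_cocycle s \<psi>" for \<psi>
    using that by (simp add: carrier_HC cochain_of_cocycle_iff)
  have d: "cochain_of (\<lambda>a. \<psi> a + \<psi>' a) = (\<lambda>xs. cochain_of \<psi> xs + cochain_of \<psi>' xs)"
    "cochain_of (\<lambda>a. c * \<psi> a) = (\<lambda>xs. c * cochain_of \<psi> xs)"
    by (auto simp: cochain_of_def fun_eq_iff split: list.splits)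
  show "HC_even_class s \<psi> \<oplus>\<^bsub>HC_even s\<^esub> HC_even_class s \<psi>' = HC_even_class s (\<lambda>a. \<psi> a + \<psi>' a)"
    unfolding HC_even_class_def HC_even_def HC_seq.dirlim_add[OF c[OF assms(1)] c[OF assms(2)]]
    by (simp add: HC_add d)
  show "c \<odot>\<^bsub>HC_even s\<^esub> HC_even_class s \<psi> = HC_even_class s (\<lambda>a. c * \<psi> a)"
    unfolding HC_even_class_def HC_even_def HC_seq.dirlim_smult[OF c[OF assms(1)]]
    by (simp add: HC_smult d)
qed

lemma cyclic_0_cocycle_comb:
  assumes "cyclic_0_cocycle s \<psi>" "cyclic_0_cocycle s \<psi>'"
  shows "cyclic_0_cocycle s (\<lambda>a. c * \<psi> a + d * \<psi>' a)"
proof -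
  have "cochain_of (\<lambda>a. c * \<psi> a + d * \<psi>' a) = (\<lambda>xs. c * cochain_of \<psi> xs + d * cochain_of \<psi>' xs)"
    by (auto simp: cochain_of_def fun_eq_iff split: list.splits)
  then show ?thesis
    using assms by (simp add: cyclic_cocycles_comb flip: cochain_of_cocycle_iff)
qed

text \<open>
  If the Hochschild cohomology vanishes in all degrees from two on, then \<open>S\<close> is onto in those degrees
  by \<open>connes_S_onto\<close>, so that every class of degree \<open>2 n\<close> is \<open>S\<^sup>n\<close> of the class of a trace,
  and in the direct limit it equals the class of that trace.
\<close>

lemma HC_even_generated_by_traces:
  assumes vanish: "\<And>m \<phi>. \<phi> \<in> cochains s (m + 2) \<Longrightarrow> hochschild_b (m + 2) \<phi> = (\<lambda>_. 0) \<Longrightarrow>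
    \<exists>\<eta>\<in>cochains s (m + 1). hochschild_b (m + 1) \<eta> = \<phi>"
  shows "carrier (HC_even s) = {HC_even_class s \<psi> | \<psi>. cyclic_0_cocycle s \<psi>}"
proof -
  have onto: "\<exists>\<psi>. cyclic_0_cocycle s \<psi> \<and> HC_class s (2 * n) \<phi> = HC_class s (2 * n) (connes_S_power n (cochain_of \<psi>))"
    if "\<phi> \<in> cyclic_cocycles s (2 * n)" for n \<phi>
    using that
  proof (induction n arbitrary: \<phi>)
    case 0
    then have \<phi>: "\<phi> \<in> cochains s 0" by (simp add: cyclic_cocycles_def cyclic_cochains_iff)
    have eq: "\<phi> = cochain_of (\<lambda>a. \<phi> [a])"
      using cochain_eq_0[OF \<phi>] by (auto simp: cochain_of_def fun_eq_iff split: list.splits)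
    have "cyclic_0_cocycle s (\<lambda>a. \<phi> [a])"
      unfolding cochain_of_cocycle_iff[symmetric] eq[symmetric] using 0 by simp
    then show ?case
      by (intro exI[of _ "\<lambda>a. \<phi> [a]"]) (simp flip: eq)
  next
    case (Suc n)
    then have \<phi>: "\<phi> \<in> cyclic_cochains s (2 * n + 2)" "hochschild_b (2 * n + 2) \<phi> = (\<lambda>_. 0)"
      by (simp_all add: cyclic_cocycles_def)
    then obtain \<eta> where \<eta>: "\<eta> \<in> cochains s (Suc (2 * n))" "hochschild_b (Suc (2 * n)) \<eta> = \<phi>"
      using vanish[of \<phi> "2 * n"] by (auto simp: cyclic_cochains_iff)
    obtain \<nu> \<kappa> where \<nu>: "\<nu> \<in> cyclic_cocycles s (2 * n)" and \<kappa>: "\<kappa> \<in> cyclic_cochains s (Suc (2 * n))"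
      and dec: "\<And>xs. \<phi> xs = connes_S (2 * n) \<nu> xs + hochschild_b (Suc (2 * n)) \<kappa> xs"
      using connes_S_onto[OF \<phi>(1) \<eta>] by metis
    obtain \<psi> where \<psi>: "cyclic_0_cocycle s \<psi>"
      "HC_class s (2 * n) \<nu> = HC_class s (2 * n) (connes_S_power n (cochain_of \<psi>))"
      using Suc.IH[OF \<nu>] by blast
    have "(\<lambda>xs. \<phi> xs - connes_S (2 * n) \<nu> xs) = hochschild_b (Suc (2 * n)) \<kappa>"
      by (simp add: dec)
    then have "HC_class s (2 * n + 2) \<phi> = HC_class s (2 * n + 2) (connes_S (2 * n) \<nu>)"
      using \<kappa> by (simp add: HC_class_eq_iff cyclic_coboundaries_def)
    also have "\<dots> = HC_S s (2 * n) (HC_class s (2 * n) \<nu>)"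
      by (simp add: HC_S_class)
    also have "\<dots> = HC_class s (2 * n + 2) (connes_S_power (Suc n) (cochain_of \<psi>))"
      unfolding \<psi>(2) HC_S_class by simp
    finally show ?case using \<psi>(1) by (intro exI[of _ \<psi>]) simp
  qed
  have "HC_even_class s \<psi> \<in> carrier (HC_even s)" if "cyclic_0_cocycle s \<psi>" for \<psi>
    unfolding HC_even_def HC_even_class_def HC_seq.carrier_dirlim
    using that by (auto simp: carrier_HC cochain_of_cocycle_iff intro!: exI[of _ 0])
  moreover have "X \<in> {HC_even_class s \<psi> | \<psi>. cyclic_0_cocycle s \<psi>}" if "X \<in> carrier (HC_even s)" for X
  proof -
    obtain n x where x: "x \<in> carrier (HC s (2 * n))"
      and X: "X = dirlim_in (\<lambda>n. HC s (2 * n)) (\<lambda>n. HC_S s (2 * n)) n x"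
      using \<open>X \<in> carrier (HC_even s)\<close> unfolding HC_even_def HC_seq.carrier_dirlim by blast
    obtain \<phi> where \<phi>: "\<phi> \<in> cyclic_cocycles s (2 * n)" "x = HC_class s (2 * n) \<phi>"
      using x by (auto simp: carrier_HC)
    obtain \<psi> where \<psi>: "cyclic_0_cocycle s \<psi>" "x = HC_class s (2 * n) (connes_S_power n (cochain_of \<psi>))"
      using onto[OF \<phi>(1)] \<phi>(2) by blast
    have c: "HC_class s 0 (cochain_of \<psi>) \<in> carrier (HC s (2 * 0))"
      using \<psi>(1) by (simp add: carrier_HC cochain_of_cocycle_iff)
    have "X = HC_even_class s \<psi>"
      unfolding X HC_even_class_def HC_seq.dirlim_in_eq_iff[OF x c]
      by (rule exI[of _ n]) (simp add: fold_HC_S \<psi>(2))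
    then show ?thesis using \<psi>(1) by blast
  qed
  ultimately show ?thesis by blast
qed

end

section \<open>Evaluation at idempotents\<close>

lemma merge_replicate:
  assumes "p * p = p" "Suc i < n"
  shows "merge i (replicate n p) = replicate (n - 1) p"
proof (rule nth_equalityI)
  fix k assume "k < length (merge i (replicate n p))"
  then show "merge i (replicate n p) ! k = replicate (n - 1) p ! k"
    using assms by (auto simp: merge_def nth_append nth_Cons')
qed (use assms in \<open>simp add: merge_def\<close>)

lemma face_replicate:
  assumes "p * p = p"
  shows "face i (replicate (n + 2) p) = replicate (n + 1) p"
proof (cases "i \<le> n")
  case True
  then show ?thesis using merge_replicate[OF assms(1), of i "n + 2"] by (simp add: face_def)
next
  case False
  have "butlast (replicate (n + 2) p) = replicate (n + 1) p"
    by (simp add: butlast_conv_take del: replicate.simps)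
  then show ?thesis using assms False by (simp add: face_def)
qed

text \<open>
  All double faces of \<open>(p, \<dots>, p)\<close> agree, and the alternating inner sum is \<open>1\<close> for odd
  \<open>i\<close> and \<open>0\<close> for even \<open>i\<close>.
\<close>

lemma connes_S_replicate:
  assumes p: "p * p = p"
  shows "connes_S (2 * m) \<phi> (replicate (2 * m + 3) p) = (of_nat m + 1) * \<phi> (replicate (2 * m + 1) p)"
proof -
  have "merge j (merge i (replicate (2 * m + 3) p)) = replicate (2 * m + 1) p" if "i \<le> 2 * m + 1" "j < i" for i j
    using that merge_replicate[OF p, of i "2 * m + 3"] merge_replicate[OF p, of j "2 * m + 2"] by simp
  then have "connes_S (2 * m) \<phi> (replicate (2 * m + 3) p) =
      (\<Sum>i = 1..2 * m + 1. \<Sum>j<i. (-1) ^ (i - 1 - j) * \<phi> (replicate (2 * m + 1) p))"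
    unfolding connes_S_def length_replicate if_P[OF refl] by (intro sum.cong refl) simp
  also have "\<dots> = (\<Sum>i = 1..2 * m + 1. \<Sum>j<i. (-1) ^ (i - 1 - j)) * \<phi> (replicate (2 * m + 1) p)"
    by (simp only: sum_distrib_right)
  finally have *: "connes_S (2 * m) \<phi> (replicate (2 * m + 3) p) =
      (\<Sum>i = 1..2 * m + 1. \<Sum>j<i. (-1) ^ (i - 1 - j)) * \<phi> (replicate (2 * m + 1) p)" .
  have alt: "(\<Sum>j<i. (-1 :: complex) ^ (i - 1 - j)) = (if odd i then 1 else 0)" for i
    by (induction i) (simp_all add: sum.lessThan_Suc_shift del: sum.lessThan_Suc)
  have "(\<Sum>i = 1..2 * m + 1. if odd i then 1 else 0) = (of_nat m + 1 :: complex)"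
    by (induction m) simp_all
  then show ?thesis unfolding * alt by simp
qed

context complex_algebra
begin

text \<open>
  A cyclic cochain of odd degree vanishes at \<open>(p, \<dots>, p)\<close>, as rotation changes its sign there. All
  faces of \<open>(p, \<dots>, p)\<close> are again of this form.
\<close>

lemma coboundary_idempotent:
  assumes p: "p * p = p" and \<beta>: "\<beta> \<in> cyclic_coboundaries s (2 * k)"
  shows "\<beta> (replicate (2 * k + 1) p) = 0"
proof (cases k)
  case 0
  then show ?thesis using \<beta> by (simp add: cyclic_coboundaries_def)
next
  case (Suc m)
  then obtain \<kappa> where \<kappa>: "\<kappa> \<in> cyclic_cochains s (2 * m + 1)" "\<beta> = hochschild_b (2 * m + 1) \<kappa>"
    using \<beta> by (auto simp: cyclic_coboundaries_def)
  define r where "r = replicate (2 * m + 2) p"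
  have len: "length r = 2 * m + 2" by (simp add: r_def)
  have "\<kappa> (rotate1 r) = - \<kappa> r"
    using \<kappa>(1) len by (simp add: cyclic_cochains_def)
  moreover have "rotate1 r = r"
    by (rule nth_equalityI) (simp_all add: nth_rotate1 r_def del: replicate.simps)
  ultimately have "\<kappa> (replicate (2 * m + 2) p) = 0" by (simp add: r_def)
  then show ?thesis
    using Suc face_replicate[OF p, of _ "2 * m + 1"]
    by (simp add: \<kappa>(2) hochschild_b_face numeral_3_eq_3 del: replicate.simps)
qed

lemma connes_S_power_idempotent:
  assumes p: "p * p = p"
  shows "connes_S_power k \<phi> (replicate (2 * k + 1) p) = fact k * \<phi> [p]"
proof (induction k)
  case (Suc k)
  then show ?case
    using connes_S_replicate[OF p, of k "connes_S_power k \<phi>"] by (simp add: numeral_3_eq_3 algebra_simps)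
qed simp

text \<open>
  The pairing of even periodic cyclic cohomology with an idempotent: evaluation at \<open>(p, \<dots>, p)\<close>
  kills coboundaries, and \<open>S\<close> multiplies it by a nonzero number.
\<close>

lemma HC_even_class_idempotent:
  assumes "cyclic_0_cocycle s \<psi>" "cyclic_0_cocycle s \<psi>'" "HC_even_class s \<psi> = HC_even_class s \<psi>'"
    and p: "p * p = p"
  shows "\<psi> p = \<psi>' p"
proof -
  obtain k where "connes_S_power k (cochain_of (\<lambda>a. \<psi> a - \<psi>' a)) \<in> cyclic_coboundaries s (2 * k)"
    using assms by (auto simp: HC_even_class_eq_iff)
  from coboundary_idempotent[OF p this] show ?thesis
    by (simp only: connes_S_power_idempotent[OF p]) (simp add: cochain_of_def)
qed

end


section \<open>The infinite dihedral group\<close>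

lemma cyclic_0_cocycleI:
  fixes \<psi> :: "('g::monoid_add \<Rightarrow>\<^sub>0 complex) \<Rightarrow> complex"
  assumes \<psi>: "lin_functional grp_scale \<psi>"
    and comm: "\<And>g h. \<psi> (grp_elem (g + h)) = \<psi> (grp_elem (h + g))"
  shows "cyclic_0_cocycle grp_scale \<psi>"
  unfolding cyclic_0_cocycle_def
proof (intro conjI \<psi> allI)
  have lin: "lin_functional grp_scale (\<lambda>x. \<psi> (x * y))" "lin_functional grp_scale (\<lambda>x. \<psi> (y * x))" for y
    using \<psi> unfolding grp.lin_functional_iff
    by (simp_all add: distrib_left distrib_right grp.mult_scale_left grp.mult_scale_right)
  have "\<psi> (grp_elem g * y) = \<psi> (y * grp_elem g)" for g y
    by (rule lin_functional_ext[OF lin(2) lin(1)]) (simp add: grp_elem_mult comm)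
  then show "\<psi> (x * y) = \<psi> (y * x)" for x y
    by (rule lin_functional_ext[OF lin])
qed

lemma half_sum_idempotent:
  fixes g :: "'g::monoid_add"
  assumes "g + g = 0"
  defines "p \<equiv> grp_scale (1 / 2) (1 + grp_elem g)"
  shows "p * p = p"
proof -
  have "(1 + grp_elem g) * (1 + grp_elem g) = (1 + grp_elem g) + (1 + grp_elem g)"
    using assms by (simp add: distrib_left distrib_right grp_elem_mult)
  then have "p * p = grp_scale (1 / 4) ((1 + grp_elem g) + (1 + grp_elem g))"
    by (simp only: p_def grp.mult_scale_left grp.mult_scale_right grp.scale_scale) simp
  also have "\<dots> = p"
    unfolding p_def grp.scale_right_distrib[of _ "1 + grp_elem g"]
    by (simp only: grp.scale_left_distrib[symmetric]) simp
  finally show ?thesis .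
qed

text \<open>
  Conjugation by \<open>S\<close> shifts the exponent of a reflection by two.
\<close>

lemma trace_reflection:
  fixes \<psi> :: "(dihedral \<Rightarrow>\<^sub>0 complex) \<Rightarrow> complex"
  assumes "cyclic_0_cocycle grp_scale \<psi>"
  shows "\<psi> (grp_elem (Dih (2 * m) True)) = \<psi> (grp_elem (Dih 0 True))"
    "\<psi> (grp_elem (Dih (2 * m + 1) True)) = \<psi> (grp_elem (Dih 1 True))"
proof -
  have comm: "\<psi> (grp_elem (g + h)) = \<psi> (grp_elem (h + g))" for g h
    using assms unfolding cyclic_0_cocycle_def by (metis grp_elem_mult)
  have step: "\<psi> (grp_elem (Dih (k + 2) True)) = \<psi> (grp_elem (Dih k True))" for k
    using comm[of "Dih 1 False + Dih k True" "Dih (-1) False"]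
    by (simp add: plus_dihedral_def add.commute)
  show "\<psi> (grp_elem (Dih (2 * m) True)) = \<psi> (grp_elem (Dih 0 True))"
  proof (induction m rule: int_induct[of _ 0])
    case (step1 i)
    then show ?case using step[of "2 * i"] by (simp add: algebra_simps)
  next
    case (step2 i)
    then show ?case using step[of "2 * (i - 1)"] by (simp add: algebra_simps)
  qed simp
  show "\<psi> (grp_elem (Dih (2 * m + 1) True)) = \<psi> (grp_elem (Dih 1 True))"
  proof (induction m rule: int_induct[of _ 0])
    case (step1 i)
    then show ?case using step[of "2 * i + 1"] by (simp add: algebra_simps)
  next
    case (step2 i)
    then show ?case using step[of "2 * (i - 1) + 1"] by (simp add: algebra_simps)
  qed simp
qed

text \<open>
  The difference of the two traces lives on the conjugacy classes of infinite order, where \<open>S\<close>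
  annihilates it.
\<close>

lemma HC_even_class_trace_eq:
  fixes \<psi> \<psi>' :: "(dihedral \<Rightarrow>\<^sub>0 complex) \<Rightarrow> complex"
  assumes \<psi>: "cyclic_0_cocycle grp_scale \<psi>" "cyclic_0_cocycle grp_scale \<psi>'"
    and eq: "\<psi> 1 = \<psi>' 1" "\<psi> (grp_elem (Dih 0 True)) = \<psi>' (grp_elem (Dih 0 True))"
      "\<psi> (grp_elem (Dih 1 True)) = \<psi>' (grp_elem (Dih 1 True))"
  shows "HC_even_class grp_scale \<psi> = HC_even_class grp_scale \<psi>'"
proof -
  define \<tau> where "\<tau> = (\<lambda>a. \<psi> a - \<psi>' a)"
  have \<tau>: "cyclic_0_cocycle grp_scale \<tau>"
    using grp.cyclic_0_cocycle_comb[OF \<psi>, of 1 "-1"] by (simp add: \<tau>_def)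
  have "\<tau> (grp_elem (Dih m True)) = 0" for m
  proof (cases "even m")
    case True
    then show ?thesis using trace_reflection(1)[OF \<tau>] eq by (auto simp: \<tau>_def elim!: evenE)
  next
    case False
    then show ?thesis using trace_reflection(2)[OF \<tau>] eq by (auto simp: \<tau>_def elim!: oddE)
  qed
  moreover have "\<tau> 1 = 0" using eq by (simp add: \<tau>_def)
  ultimately have "connes_S 0 (cochain_of \<tau>) \<in> hochschild_b 1 ` cyclic_cochains grp_scale 1"
    using connes_S_trace_coboundary[OF \<tau>] by blast
  then have "connes_S_power 1 (cochain_of \<tau>) \<in> cyclic_coboundaries grp_scale (2 * 1)"
    by (simp add: cyclic_coboundaries_def numeral_2_eq_2)
  then show ?thesis
    unfolding grp.HC_even_class_eq_iff[OF \<psi>] \<tau>_def by blast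
qed

text \<open>
  An isomorphism is easier to construct out of the coordinate space, which is visibly a group, than into
  it.
\<close>

lemma iso_coord_space_inverse:
  fixes L :: "complex ^ 'n \<Rightarrow> 'b"
  assumes bij: "bij_betw L UNIV (carrier H)"
    and add: "\<And>v w. L (v + w) = L v \<oplus>\<^bsub>H\<^esub> L w"
    and smult: "\<And>c v. L (c *s v) = c \<odot>\<^bsub>H\<^esub> L v"
  shows "inv_into UNIV L \<in> space_iso H (coord_space :: (complex, complex ^ 'n) module)"
proof -
  let ?C = "add_monoid (coord_space :: (complex, complex ^ 'n) module)"
  have C: "carrier ?C = UNIV" by (simp add: coord_space_def)
  have "group ?C"
  proof (rule groupI)
    fix x assume "x \<in> carrier ?C"
    show "\<exists>y\<in>carrier ?C. y \<otimes>\<^bsub>?C\<^esub> x = \<one>\<^bsub>?C\<^esub>"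
      by (rule bexI[of _ "- x"]) (simp_all add: coord_space_def)
  qed (simp_all add: coord_space_def add.assoc)
  moreover have "L \<in> iso ?C (add_monoid H)"
    using bij add bij_betwE[OF bij] by (auto simp: iso_def hom_def coord_space_def)
  ultimately have "inv_into (carrier ?C) L \<in> iso (add_monoid H) ?C"
    by (rule group.iso_set_sym)
  then have 1: "inv_into UNIV L \<in> iso (add_monoid H) ?C" by (simp only: C)
  have "inv_into UNIV L (c \<odot>\<^bsub>H\<^esub> x) = c \<odot>\<^bsub>coord_space\<^esub> inv_into UNIV L x" if x: "x \<in> carrier H" for c x
  proof -
    have inj: "inj L" using bij by (rule bij_betw_imp_inj_on)
    obtain v where "x = L v" using bij x by (auto simp: bij_betw_def)
    then show ?thesis
      by (simp add: inj smult[symmetric] coord_space_def)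
  qed
  with 1 show ?thesis by (simp add: space_iso_def)
qed

theorem proposition14:
  fixes \<psi>\<^sub>0 \<psi>\<^sub>1 \<psi>\<^sub>2 :: "(dihedral \<Rightarrow>\<^sub>0 complex) \<Rightarrow> complex"
  assumes lin: "lin_functional grp_scale \<psi>\<^sub>0" "lin_functional grp_scale \<psi>\<^sub>1"
      "lin_functional grp_scale \<psi>\<^sub>2"
    and \<psi>\<^sub>0: "\<And>m. \<psi>\<^sub>0 (grp_elem (Dih m False)) = (if m = 0 then 1 else 0)"
      "\<And>m. \<psi>\<^sub>0 (grp_elem (Dih m True)) = 0"
    and \<psi>\<^sub>1: "\<And>m. \<psi>\<^sub>1 (grp_elem (Dih m False)) = 0"
      "\<And>m. \<psi>\<^sub>1 (grp_elem (Dih (2 * m) True)) = 2"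
      "\<And>m. \<psi>\<^sub>1 (grp_elem (Dih (2 * m + 1) True)) = 0"
    and \<psi>\<^sub>2: "\<And>m. \<psi>\<^sub>2 (grp_elem (Dih m False)) = 0"
      "\<And>m. \<psi>\<^sub>2 (grp_elem (Dih (2 * m) True)) = 0"
      "\<And>m. \<psi>\<^sub>2 (grp_elem (Dih (2 * m + 1) True)) = 2"
  defines "H \<equiv> HC_even (grp_scale :: complex \<Rightarrow> (dihedral \<Rightarrow>\<^sub>0 complex) \<Rightarrow> _)"
    and "cls \<equiv> HC_even_class grp_scale"
  shows "cyclic_0_cocycle grp_scale \<psi>\<^sub>0 \<and> cyclic_0_cocycle grp_scale \<psi>\<^sub>1 \<and>
         cyclic_0_cocycle grp_scale \<psi>\<^sub>2 \<and>
         carrier H = {c\<^sub>0 \<odot>\<^bsub>H\<^esub> cls \<psi>\<^sub>0 \<oplus>\<^bsub>H\<^esub> c\<^sub>1 \<odot>\<^bsub>H\<^esub> cls \<psi>\<^sub>1 \<oplus>\<^bsub>H\<^esub> c\<^sub>2 \<odot>\<^bsub>H\<^esub> cls \<psi>\<^sub>2 | c\<^sub>0 c\<^sub>1 c\<^sub>2. True} \<and>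
         space_iso H (coord_space :: (complex, complex ^ 3) module) \<noteq> {}"
proof -
  have 1: "\<psi>\<^sub>1 (grp_elem (Dih m True)) = (if even m then 2 else 0)" for m
    using \<psi>\<^sub>1 by (cases "even m") (auto elim!: evenE oddE)
  have 2: "\<psi>\<^sub>2 (grp_elem (Dih m True)) = (if even m then 0 else 2)" for m
    using \<psi>\<^sub>2 by (cases "even m") (auto elim!: evenE oddE)
  have comm: "\<psi>\<^sub>0 (grp_elem (g + h)) = \<psi>\<^sub>0 (grp_elem (h + g))"
    "\<psi>\<^sub>1 (grp_elem (g + h)) = \<psi>\<^sub>1 (grp_elem (h + g))"
    "\<psi>\<^sub>2 (grp_elem (g + h)) = \<psi>\<^sub>2 (grp_elem (h + g))" for g h
    by (cases g; cases h; cases "flip g"; cases "flip h";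
        simp add: plus_dihedral_def \<psi>\<^sub>0 \<psi>\<^sub>1(1) \<psi>\<^sub>2(1) 1 2 add.commute; fail)+
  have tr: "cyclic_0_cocycle grp_scale \<psi>\<^sub>0" "cyclic_0_cocycle grp_scale \<psi>\<^sub>1" "cyclic_0_cocycle grp_scale \<psi>\<^sub>2"
    using lin comm by (auto intro!: cyclic_0_cocycleI)
  define comb where "comb = (\<lambda>c0 c1 c2 a. (c0 * \<psi>\<^sub>0 a + c1 * \<psi>\<^sub>1 a) + c2 * \<psi>\<^sub>2 a)"
  have trc: "cyclic_0_cocycle grp_scale (comb c0 c1 c2)" for c0 c1 c2
  proof -
    have "cyclic_0_cocycle grp_scale (\<lambda>a. 1 * (c0 * \<psi>\<^sub>0 a + c1 * \<psi>\<^sub>1 a) + c2 * \<psi>\<^sub>2 a)"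
      by (rule grp.cyclic_0_cocycle_comb[OF grp.cyclic_0_cocycle_comb[OF tr(1,2)] tr(3)])
    then show ?thesis by (simp add: comb_def)
  qed
  have scale: "cyclic_0_cocycle grp_scale (\<lambda>a. c * \<psi> a)" if "cyclic_0_cocycle grp_scale \<psi>"
    for c and \<psi> :: "(dihedral \<Rightarrow>\<^sub>0 complex) \<Rightarrow> complex"
    using grp.cyclic_0_cocycle_comb[OF that that, of c 0] by simp
  have cls_comb: "c0 \<odot>\<^bsub>H\<^esub> cls \<psi>\<^sub>0 \<oplus>\<^bsub>H\<^esub> c1 \<odot>\<^bsub>H\<^esub> cls \<psi>\<^sub>1 \<oplus>\<^bsub>H\<^esub> c2 \<odot>\<^bsub>H\<^esub> cls \<psi>\<^sub>2 = cls (comb c0 c1 c2)"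
    for c0 c1 c2
  proof -
    have "cyclic_0_cocycle grp_scale (\<lambda>a. c0 * \<psi>\<^sub>0 a + c1 * \<psi>\<^sub>1 a)"
      by (rule grp.cyclic_0_cocycle_comb[OF tr(1,2)])
    then show ?thesis
      unfolding H_def cls_def comb_def
      by (simp add: grp.HC_even_comb(2)[OF tr(1) tr(1)] grp.HC_even_comb(2)[OF tr(2) tr(2)]
          grp.HC_even_comb(2)[OF tr(3) tr(3)] grp.HC_even_comb(1) scale tr)
  qed
  \<comment> \<open>up to a factor \<open>2\<close>, the values at \<open>1\<close>, \<open>e\<close> and \<open>S e\<close> are the coordinates of a combination\<close>
  have vals: "comb c0 c1 c2 1 = c0" "comb c0 c1 c2 (grp_elem (Dih 0 True)) = 2 * c1"
    "comb c0 c1 c2 (grp_elem (Dih 1 True)) = 2 * c2" for c0 c1 c2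
  proof -
    have "grp_elem (Dih 0 False) = (1 :: dihedral \<Rightarrow>\<^sub>0 complex)"
      by (simp flip: zero_dihedral_def)
    then show "comb c0 c1 c2 1 = c0" using \<psi>\<^sub>0(1)[of 0] \<psi>\<^sub>1(1)[of 0] \<psi>\<^sub>2(1)[of 0] by (simp add: comb_def)
  qed (simp_all add: comb_def \<psi>\<^sub>0 1 2)
  have "\<exists>\<eta>\<in>cochains grp_scale (m + 1). hochschild_b (m + 1) \<eta> = \<phi>"
    if "\<phi> \<in> cochains grp_scale (m + 2)" "hochschild_b (m + 2) \<phi> = (\<lambda>_. 0)"
    for m and \<phi> :: "(dihedral \<Rightarrow>\<^sub>0 complex) list \<Rightarrow> complex"
    using cochain_contract[OF that(1)] hochschild_vanishing[OF that] by blast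
  then have gen: "carrier H = {cls \<psi> | \<psi>. cyclic_0_cocycle grp_scale \<psi>}"
    unfolding H_def cls_def by (rule grp.HC_even_generated_by_traces)
  have onto: "\<exists>c0 c1 c2. X = cls (comb c0 c1 c2)" if X: "X \<in> carrier H" for X
  proof -
    obtain \<psi> where \<psi>: "cyclic_0_cocycle grp_scale \<psi>" "X = cls \<psi>"
      using X unfolding gen by blast
    have "cls \<psi> = cls (comb (\<psi> 1) (\<psi> (grp_elem (Dih 0 True)) / 2) (\<psi> (grp_elem (Dih 1 True)) / 2))"
      unfolding cls_def by (rule HC_even_class_trace_eq[OF \<psi>(1) trc]) (simp_all add: vals)
    then show ?thesis using \<psi>(2) by blast
  qed
  have mem: "cls (comb c0 c1 c2) \<in> carrier H" for c0 c1 c2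
    unfolding gen using trc by blast
  define L where "L = (\<lambda>v :: complex ^ 3. cls (comb (v $ 1) (v $ 2) (v $ 3)))"
  have inj: "v = w" if "L v = L w" for v w
  proof -
    have eval: "comb (v $ 1) (v $ 2) (v $ 3) p = comb (w $ 1) (w $ 2) (w $ 3) p" if "p * p = p" for p
      using grp.HC_even_class_idempotent[OF trc trc _ that] \<open>L v = L w\<close> unfolding L_def cls_def by blast
    have half: "comb c0 c1 c2 (grp_scale (1 / 2) (1 + grp_elem g)) = (comb c0 c1 c2 1 + comb c0 c1 c2 (grp_elem g)) / 2"
      for c0 c1 c2 g
      using trc[of c0 c1 c2] by (simp add: cyclic_0_cocycle_def grp.lin_functional_iff)
    have "Dih 0 True + Dih 0 True = 0" "Dih 1 True + Dih 1 True = 0"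
      by (simp_all add: plus_dihedral_def zero_dihedral_def)
    then have "v $ 1 = w $ 1" "v $ 2 = w $ 2" "v $ 3 = w $ 3"
      using eval[of 1] eval[OF half_sum_idempotent[of "Dih 0 True"]]
        eval[OF half_sum_idempotent[of "Dih 1 True"]] by (auto simp: half vals)
    then show ?thesis by (simp add: vec_eq_iff forall_3)
  qed
  have "bij_betw L UNIV (carrier H)"
  proof (intro bij_betw_imageI injI inj equalityI subsetI)
    fix X assume "X \<in> carrier H"
    then obtain c0 c1 c2 where "X = cls (comb c0 c1 c2)" using onto by blast
    then have "X = L (vector [c0, c1, c2])" by (simp add: L_def)
    then show "X \<in> range L" by blast
  qed (auto simp: L_def mem)
  moreover have "L (v + w) = L v \<oplus>\<^bsub>H\<^esub> L w" for v w
    unfolding L_def H_def cls_def grp.HC_even_comb(1)[OF trc trc]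
    by (simp add: comb_def algebra_simps)
  moreover have "L (c *s v) = c \<odot>\<^bsub>H\<^esub> L v" for c v
    unfolding L_def H_def cls_def grp.HC_even_comb(2)[OF trc trc]
    by (simp add: comb_def algebra_simps)
  ultimately have "inv_into UNIV L \<in> space_iso H (coord_space :: (complex, complex ^ 3) module)"
    by (rule iso_coord_space_inverse)
  moreover have "carrier H = {c\<^sub>0 \<odot>\<^bsub>H\<^esub> cls \<psi>\<^sub>0 \<oplus>\<^bsub>H\<^esub> c\<^sub>1 \<odot>\<^bsub>H\<^esub> cls \<psi>\<^sub>1 \<oplus>\<^bsub>H\<^esub> c\<^sub>2 \<odot>\<^bsub>H\<^esub> cls \<psi>\<^sub>2 | c\<^sub>0 c\<^sub>1 c\<^sub>2. True}"
    unfolding cls_comb using onto mem by blast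
  ultimately show ?thesis using tr by blast
qed

end
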